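(* Let $k\ge2$ be an integer. Suppose that $G$ is an $s$-$t$ graph with $\mathsf P_k$-collapsing map $\pi$, $\nu_G$ is a probability measure on $E(G)$, and $\mathsf d_G$ is a geodesic metric on $V(G)$. If 1. $\nu_G$ is uniform, 2. the pushforward $\nu_{\mathsf P_k}:=\pi_\#\nu_G$ on $E(\mathsf P_k)$ is reflection invariant, 3. $G$ admits a nonzero base function $\phi$, and 4. $\mathsf d_G(e)=\frac1k$ for every $e\in E(G)$, then for every $n\ge1$, $G^{\oslash n}$ has $(\mu(\nu_G^{\oslash n}),\mathsf d_G^{\oslash n})$-Lipschitz-spectral profile of dimension $\frac{\log|E(G)|}{\log k}$ and bandwidth $k^n$, with some constants $C_1\le2\frac{\|\phi\|_{L_\infty(\mu(\nu_G))}}{\|\phi\|_{L_1(\mu(\nu_G))}}$, $C_\infty\le1$, $C_\gamma\le2|E(G)|^2$.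
   Context: **Graphs.** Graphs are finite, connected, directed, with at least one edge, without self-loops or multiple edges between the same pair of vertices. For $e=(u,v)\in E(G)$, $e^-=u$, $e^+=v$. A metric $\mathsf d$ on $V(G)$ is geodesic if any $x,y$ are joined by a path (edges traversed in either direction) $u_0=x,\dots,u_k=y$ with $\mathsf d(x,y)=\sum_i\mathsf d(u_{i-1},u_i)$; $\mathsf d(e)=\mathsf d(e^-,e^+)$. An $s$-$t$ graph is a graph with two distinct distinguished vertices $s(G),t(G)$ such that every vertex lies on a directed path from $s(G)$ to $t(G)$. A graph morphism is a map on vertices sending directed edges to directed edges; it induces a map on edges. **$\oslash$-products and powers.** $V(H\oslash G)=E(H)\times V(G)/\sim$, where $(e_1,u_1)\sim(e_2,u_2)$ iff they are equal, or $u_1,u_2\in\{s(G),t(G)\}$ and the corresponding endpoints in $H$ coincide ($(e,s(G))$ corresponds to $e^-$, $(e,t(G))$ to $e^+$). The class of $(e,u)$ is $e\oslash u$; edges are $e\oslash f:=(e\oslash f^-,e\oslash f^+)$, $(e,f)\in E(H)\times E(G)$. If $H$ is $s$-$t$, so is $H\oslash G$, with source and sink those of $H$ (viewing $V(H)\subset V(H\oslash G)$). $(\nu_H\oslash\nu_G)(e\oslash f)=\nu_H(e)\nu_G(f)$; $\mathsf d_H\oslash\mathsf d_G$ is the unique geodesic metric on $V(H\oslash G)$ with $(\mathsf d_H\oslash\mathsf d_G)(e\oslash f)=\mathsf d_H(e)\mathsf d_G(f)$. $G^{\oslash1}=G$, $G^{\oslash(n+1)}=G^{\oslash n}\oslash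 G$; likewise $\nu_G^{\oslash n},\mathsf d_G^{\oslash n}$. **Induced vertex measure.** $\mu(\nu)(x)=\frac12\sum_{e:\,x\in\{e^-,e^+\}}\nu(e)$. **Collapsing maps.** $\mathsf P_k$ is the path with vertices $\{i/k:0\le i\le k\}$ and edges $\varepsilon_j=(\frac{j-1}k,\frac jk)$, $1\le j\le k$. A $\mathsf P_k$-collapsing map is a graph morphism $\pi:V(G)\to V(\mathsf P_k)$ with $\pi^{-1}(\{0\})=\{s(G)\}$, $\pi^{-1}(\{1\})=\{t(G)\}$. A measure $\nu$ on $E(\mathsf P_k)$ is reflection invariant if $\nu(\varepsilon_j)=\nu(\varepsilon_{k-j+1})$ for all $1\le j\le k$. **Base functions.** For $\phi:V(G)\to\mathbb R$ let $\phi_\pm:E(G)\to\mathbb R$, $\phi_\pm(e)=\phi(e^\pm)$. $\phi$ has the edge-sign property if $\phi(e^-)\phi(e^+)\ge0$ for all $e\in E(G)$. $\mathbb E^\pi_{\nu_G}$ is the conditional expectation on $(E(G),\nu_G)$ with respect to the $\sigma$-algebra generated by $\pi:E(G)\to E(\mathsf P_k)$. $\phi$ is a base function of $G$ if it has the edge-sign property and, with $\nu_G$ uniform, $\mathbb E^\pi_{\nu_G}(\phi_-)=\mathbb E^\pi_{\nu_G}(\phi_+)=0$. **Lipschitz-spectral profile.** For a family $F=\{f_i\}_{i\in I}$ of Lipschitz functions, $\gamma_F(s)=|\{i\in I:\mathrm{Lip}(f_i)\le s\}|$. For $\delta,\beta\in[1,\infty)$, a graph $K$ has $(\mu,\mathsf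 d)$-Lipschitz-spectral profile of dimension $\delta$ and bandwidth $\beta$ with constants $C_1,C_\infty,C_\gamma\in(0,\infty)$ if there is a collection $F=\{f_i:V(K)\to\mathbb R\}_{i\in I}$ such that (1) $C_1^{-1}\le\inf_i\|f_i\|_{L_1(\mu)}\le\sup_i\|f_i\|_{L_\infty(\mu)}\le C_\infty$; (2) $\{f_i\}$ is orthogonal in $L_2(\mu)$; (3) for every $s\in[1,\beta]$, $\gamma_F(s)\ge C_\gamma^{-1}s^\delta$. *)

theory Defs
  imports
    "HOL-Analysis.Analysis"
    "HOL-Probability.Probability"
    "HOL-Library.FSet"
    "Graph_Theory.Pair_Digraph"
    "Graph_Theory.Digraph_Component"
    "Graph_Theory.Vertex_Walk"
begin

record 'a st_digraph =
  graph_of :: "'a pair_pre_digraph"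
  source :: 'a
  sink :: 'a

abbreviation V :: "'a st_digraph \<Rightarrow> 'a set" where
  "V G \<equiv> pverts (graph_of G)"

abbreviation E :: "'a st_digraph \<Rightarrow> ('a \<times> 'a) set" where
  "E G \<equiv> parcs (graph_of G)"

text \<open>Edges are pairs of vertices, so parallel edges in the same direction cannot occur; the last
  conjunct excludes antiparallel ones.\<close>

definition admissible_graph :: "'a pair_pre_digraph \<Rightarrow> bool" where
  "admissible_graph D \<longleftrightarrow>
     pair_digraph D \<and> connected (with_proj D) \<and> parcs D \<noteq> {} \<and>
     (\<forall>u v. (u, v) \<in> parcs D \<longrightarrow> (v, u) \<notin> parcs D)"

definition st_graph :: "'a st_digraph \<Rightarrow> bool" where
  "st_graph G \<longleftrightarrow>
     admissible_graph (graph_of G) \<and> source G \<in> V G \<and> sink G \<in> V G \<and> source G \<noteq> sink G \<and>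
     (\<forall>v \<in> V G. \<exists>p. vwalk p (with_proj (graph_of G)) \<and>
        hd p = source G \<and> last p = sink G \<and> v \<in> set p)"

abbreviation edge_len :: "('a \<Rightarrow> 'a \<Rightarrow> real) \<Rightarrow> 'a \<times> 'a \<Rightarrow> real" where
  "edge_len d e \<equiv> d (fst e) (snd e)"

definition geodesic_metric :: "'a pair_pre_digraph \<Rightarrow> ('a \<Rightarrow> 'a \<Rightarrow> real) \<Rightarrow> bool" where
  "geodesic_metric D d \<longleftrightarrow>
     Metric_space (pverts D) d \<and>
     (\<forall>x \<in> pverts D. \<forall>y \<in> pverts D.
        \<exists>p. vwalk p (with_proj (mk_symmetric (with_proj D))) \<and> hd p = x \<and> last p = y \<and>
            d x y = (\<Sum>a\<leftarrow>vwalk_arcs p. edge_len d a))"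

text \<open>For \<open>u\<close> the source or sink of \<open>G\<close>, the vertex of \<open>H\<close> to which \<open>(e, u)\<close> is glued.\<close>

definition oslash_endpoint :: "'b st_digraph \<Rightarrow> 'a \<times> 'a \<Rightarrow> 'b \<Rightarrow> 'a" where
  "oslash_endpoint G e u = (if u = source G then fst e else snd e)"

definition oslash_rel :: "'a st_digraph \<Rightarrow> 'b st_digraph \<Rightarrow>
    ((('a \<times> 'a) \<times> 'b) \<times> (('a \<times> 'a) \<times> 'b)) set" where
  "oslash_rel H G =
     {((e1, u1), (e2, u2)). e1 \<in> E H \<and> u1 \<in> V G \<and> e2 \<in> E H \<and> u2 \<in> V G \<and>
        ((e1, u1) = (e2, u2) \<or>
         u1 \<in> {source G, sink G} \<and> u2 \<in> {source G, sink G} \<and>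
         oslash_endpoint G e1 u1 = oslash_endpoint G e2 u2)}"

definition oslash_vertex :: "'a st_digraph \<Rightarrow> 'b st_digraph \<Rightarrow>
    'a \<times> 'a \<Rightarrow> 'b \<Rightarrow> (('a \<times> 'a) \<times> 'b) set" where
  "oslash_vertex H G e u = oslash_rel H G `` {(e, u)}"

definition oslash_edge :: "'a st_digraph \<Rightarrow> 'b st_digraph \<Rightarrow> 'a \<times> 'a \<Rightarrow> 'b \<times> 'b \<Rightarrow>
    (('a \<times> 'a) \<times> 'b) set \<times> (('a \<times> 'a) \<times> 'b) set" where
  "oslash_edge H G e f = (oslash_vertex H G e (fst f), oslash_vertex H G e (snd f))"

text \<open>The vertex \<open>x\<close> of \<open>H\<close> viewed in \<open>H \<oslash> G\<close>: the class of all pairs glued to \<open>x\<close>.\<close>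

definition oslash_embed :: "'a st_digraph \<Rightarrow> 'b st_digraph \<Rightarrow> 'a \<Rightarrow> (('a \<times> 'a) \<times> 'b) set" where
  "oslash_embed H G x =
     {(e, u). e \<in> E H \<and> u \<in> {source G, sink G} \<and> oslash_endpoint G e u = x}"

definition oslash :: "'a st_digraph \<Rightarrow> 'b st_digraph \<Rightarrow> (('a \<times> 'a) \<times> 'b) set st_digraph" where
  "oslash H G =
     \<lparr> graph_of = \<lparr> pverts = (E H \<times> V G) // oslash_rel H G,
                    parcs = {oslash_edge H G e f | e f. e \<in> E H \<and> f \<in> E G} \<rparr>,
       source = oslash_embed H G (source H),
       sink = oslash_embed H G (sink H) \<rparr>"

definition oslash_measure :: "'a st_digraph \<Rightarrow> 'b st_digraph \<Rightarrow>
    ('a \<times> 'a) pmf \<Rightarrow> ('b \<times> 'b) pmf \<Rightarrow>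
    ((('a \<times> 'a) \<times> 'b) set \<times> (('a \<times> 'a) \<times> 'b) set) pmf" where
  "oslash_measure H G \<nu>H \<nu>G = map_pmf (\<lambda>(e, f). oslash_edge H G e f) (pair_pmf \<nu>H \<nu>G)"

text \<open>Metrics are total functions; being zero off the vertex set makes the description unique.\<close>

definition oslash_metric :: "'a st_digraph \<Rightarrow> 'b st_digraph \<Rightarrow>
    ('a \<Rightarrow> 'a \<Rightarrow> real) \<Rightarrow> ('b \<Rightarrow> 'b \<Rightarrow> real) \<Rightarrow>
    (('a \<times> 'a) \<times> 'b) set \<Rightarrow> (('a \<times> 'a) \<times> 'b) set \<Rightarrow> real" where
  "oslash_metric H G dH dG =
     (THE d. geodesic_metric (graph_of (oslash H G)) d \<and>
        (\<forall>e \<in> E H. \<forall>f \<in> E G. edge_len d (oslash_edge H G e f) = edge_len dH e * edge_len dG f) \<and>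
        (\<forall>x y. x \<notin> V (oslash H G) \<or> y \<notin> V (oslash H G) \<longrightarrow> d x y = 0))"

text \<open>The vertex type grows with every product. To have all powers of \<open>G\<close> in a single type, vertices
  are renamed into the following type: a vertex of \<open>G\<close>, or an equivalence class (which is finite
  when the graphs are).\<close>

datatype 'a pvert = Base 'a | Cls "(('a pvert \<times> 'a pvert) \<times> 'a) fset"

definition cls :: "(('a pvert \<times> 'a pvert) \<times> 'a) set \<Rightarrow> 'a pvert" where
  "cls X = Cls (Abs_fset X)"

definition rename_graph :: "('a \<Rightarrow> 'b) \<Rightarrow> 'a st_digraph \<Rightarrow> 'b st_digraph" where
  "rename_graph h G =
     \<lparr> graph_of = \<lparr> pverts = h ` V G, parcs = map_prod h h ` E G \<rparr>,
       source = h (source G), sink = h (sink G) \<rparr>"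

definition rename_metric :: "('a \<Rightarrow> 'b) \<Rightarrow> 'a st_digraph \<Rightarrow> ('a \<Rightarrow> 'a \<Rightarrow> real) \<Rightarrow>
    'b \<Rightarrow> 'b \<Rightarrow> real" where
  "rename_metric h G d x y =
     (if x \<in> h ` V G \<and> y \<in> h ` V G then d (inv_into (V G) h x) (inv_into (V G) h y) else 0)"

text \<open>Powers start at exponent 1; exponent 0 is left unspecified.\<close>

fun oslash_power :: "'a st_digraph \<Rightarrow> nat \<Rightarrow> 'a pvert st_digraph" where
  "oslash_power G (Suc 0) = rename_graph Base G"
| "oslash_power G (Suc (Suc n)) = rename_graph cls (oslash (oslash_power G (Suc n)) G)"

fun oslash_power_measure :: "'a st_digraph \<Rightarrow> ('a \<times> 'a) pmf \<Rightarrow> nat \<Rightarrow>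
    ('a pvert \<times> 'a pvert) pmf" where
  "oslash_power_measure G \<nu> (Suc 0) = map_pmf (map_prod Base Base) \<nu>"
| "oslash_power_measure G \<nu> (Suc (Suc n)) =
     map_pmf (map_prod cls cls)
       (oslash_measure (oslash_power G (Suc n)) G (oslash_power_measure G \<nu> (Suc n)) \<nu>)"

fun oslash_power_metric :: "'a st_digraph \<Rightarrow> ('a \<Rightarrow> 'a \<Rightarrow> real) \<Rightarrow> nat \<Rightarrow>
    'a pvert \<Rightarrow> 'a pvert \<Rightarrow> real" where
  "oslash_power_metric G d (Suc 0) = rename_metric Base G d"
| "oslash_power_metric G d (Suc (Suc n)) =
     rename_metric cls (oslash (oslash_power G (Suc n)) G)
       (oslash_metric (oslash_power G (Suc n)) G (oslash_power_metric G d (Suc n)) d)"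

definition vertex_measure :: "'a st_digraph \<Rightarrow> ('a \<times> 'a) pmf \<Rightarrow> 'a measure" where
  "vertex_measure G \<nu> =
     point_measure (V G)
       (\<lambda>x. ennreal (1 / 2 * (\<Sum>e \<in> {e \<in> E G. x \<in> {fst e, snd e}}. pmf \<nu> e)))"

definition path_edge :: "nat \<Rightarrow> nat \<Rightarrow> real \<times> real" where
  "path_edge k j = ((real j - 1) / real k, real j / real k)"

definition path_graph :: "nat \<Rightarrow> real st_digraph" where
  "path_graph k =
     \<lparr> graph_of = \<lparr> pverts = {real i / real k | i. i \<le> k}, parcs = path_edge k ` {1..k} \<rparr>,
       source = 0, sink = 1 \<rparr>"

definition graph_morphism :: "'a st_digraph \<Rightarrow> 'b st_digraph \<Rightarrow> ('a \<Rightarrow> 'b) \<Rightarrow> bool" where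
  "graph_morphism G H h \<longleftrightarrow> h ` V G \<subseteq> V H \<and> map_prod h h ` E G \<subseteq> E H"

definition collapsing_map :: "nat \<Rightarrow> 'a st_digraph \<Rightarrow> ('a \<Rightarrow> real) \<Rightarrow> bool" where
  "collapsing_map k G \<pi> \<longleftrightarrow>
     graph_morphism G (path_graph k) \<pi> \<and>
     {x \<in> V G. \<pi> x = 0} = {source G} \<and> {x \<in> V G. \<pi> x = 1} = {sink G}"

definition reflection_invariant :: "nat \<Rightarrow> (real \<times> real) pmf \<Rightarrow> bool" where
  "reflection_invariant k \<nu> \<longleftrightarrow>
     (\<forall>j \<in> {1..k}. pmf \<nu> (path_edge k j) = pmf \<nu> (path_edge k (k - j + 1)))"

definition edge_sign_property :: "'a st_digraph \<Rightarrow> ('a \<Rightarrow> real) \<Rightarrow> bool" where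
  "edge_sign_property G \<phi> \<longleftrightarrow> (\<forall>e \<in> E G. \<phi> (fst e) * \<phi> (snd e) \<ge> 0)"

definition edge_space :: "'a st_digraph \<Rightarrow> ('a \<times> 'a) pmf \<Rightarrow> ('a \<times> 'a) measure" where
  "edge_space G \<nu> = restrict_space (measure_pmf \<nu>) (E G)"

definition collapsing_cond_exp :: "nat \<Rightarrow> 'a st_digraph \<Rightarrow> ('a \<Rightarrow> real) \<Rightarrow> ('a \<times> 'a) pmf \<Rightarrow>
    ('a \<times> 'a \<Rightarrow> real) \<Rightarrow> 'a \<times> 'a \<Rightarrow> real" where
  "collapsing_cond_exp k G \<pi> \<nu> f =
     real_cond_exp (edge_space G \<nu>)
       (vimage_algebra (E G) (map_prod \<pi> \<pi>) (count_space (E (path_graph k)))) f"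

definition base_function :: "nat \<Rightarrow> 'a st_digraph \<Rightarrow> ('a \<Rightarrow> real) \<Rightarrow> ('a \<Rightarrow> real) \<Rightarrow> bool" where
  "base_function k G \<pi> \<phi> \<longleftrightarrow>
     edge_sign_property G \<phi> \<and>
     (let \<nu> = pmf_of_set (E G) in
        (AE e in edge_space G \<nu>. collapsing_cond_exp k G \<pi> \<nu> (\<lambda>e. \<phi> (fst e)) e = 0) \<and>
        (AE e in edge_space G \<nu>. collapsing_cond_exp k G \<pi> \<nu> (\<lambda>e. \<phi> (snd e)) e = 0))"

definition L1_norm :: "'a measure \<Rightarrow> ('a \<Rightarrow> real) \<Rightarrow> ennreal" where
  "L1_norm \<mu> f = (\<integral>\<^sup>+ x. ennreal \<bar>f x\<bar> \<partial>\<mu>)"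

definition Linf_norm :: "'a measure \<Rightarrow> ('a \<Rightarrow> real) \<Rightarrow> ennreal" where
  "Linf_norm \<mu> f = esssup \<mu> (\<lambda>x. ennreal \<bar>f x\<bar>)"

definition Lip_const :: "'a set \<Rightarrow> ('a \<Rightarrow> 'a \<Rightarrow> real) \<Rightarrow> ('a \<Rightarrow> real) \<Rightarrow> real" where
  "Lip_const X d f = Inf {L. 0 \<le> L \<and> (\<forall>x \<in> X. \<forall>y \<in> X. \<bar>f x - f y\<bar> \<le> L * d x y)}"

text \<open>Since \<open>K\<close> is finite and the \<open>f i\<close> are orthogonal and nonzero in \<open>L\<^sub>2\<close>, the family is
  finite, so index sets of natural numbers suffice.\<close>

definition lipschitz_spectral_profile :: "'a pair_pre_digraph \<Rightarrow> 'a measure \<Rightarrow>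
    ('a \<Rightarrow> 'a \<Rightarrow> real) \<Rightarrow> real \<Rightarrow> real \<Rightarrow> real \<Rightarrow> real \<Rightarrow> real \<Rightarrow> bool" where
  "lipschitz_spectral_profile K \<mu> d \<delta> \<beta> C1 Cinf C\<gamma> \<longleftrightarrow>
     1 \<le> \<delta> \<and> 1 \<le> \<beta> \<and> 0 < C1 \<and> 0 < Cinf \<and> 0 < C\<gamma> \<and>
     (\<exists>(I :: nat set) (f :: nat \<Rightarrow> 'a \<Rightarrow> real).
        ennreal (1 / C1) \<le> (INF i\<in>I. L1_norm \<mu> (f i)) \<and>
        (INF i\<in>I. L1_norm \<mu> (f i)) \<le> (SUP i\<in>I. Linf_norm \<mu> (f i)) \<and>
        (SUP i\<in>I. Linf_norm \<mu> (f i)) \<le> ennreal Cinf \<and>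
        (\<forall>i\<in>I. \<forall>j\<in>I. i \<noteq> j \<longrightarrow> (\<integral>x. f i x * f j x \<partial>\<mu>) = 0) \<and>
        (\<forall>s \<in> {1..\<beta>}. real (card {i \<in> I. Lip_const (pverts K) d (f i) \<le> s}) \<ge> s powr \<delta> / C\<gamma>))"

end

theory Submission
  imports Defs
begin

text \<open>
  The orthogonal family on \<open>G\<^sup>n\<close> is built by induction on \<open>n\<close>, starting from \<open>1\<close> and \<open>\<phi> / M\<close> with
  \<open>M = max \<bar>\<phi>\<bar>\<close>. A function \<open>f\<close> on \<open>H = G\<^sup>n\<close> is carried to \<open>H \<oslash> G\<close> by interpolating its
  values at the ends of each edge of \<open>H\<close> along \<open>\<pi>\<close>; edge lengths shrink by the factor \<open>k\<close>, so the Lipschitz constant is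
  kept, the edge-sign property makes \<open>\<bar>f\<bar>\<close> interpolate too, and reflection invariance then keeps
  the \<open>L\<^sub>1\<close> norm. The new functions are \<open>(e, u) \<mapsto> h e * \<phi> u / M\<close>, where \<open>h\<close> runs through the Walsh
  functions on \<open>2 ^ j\<close> of the edges of \<open>H\<close>, with \<open>2 ^ j\<close> the largest power of two not exceeding
  \<open>card (E H)\<close>: rounding down to a power of two loses at most a factor two in the number of
  functions and in their \<open>L\<^sub>1\<close> norm. They are orthogonal to interpolated functions because the
  conditional expectations of \<open>\<phi>\<close> given the level of \<open>\<pi>\<close> vanish.
\<close>

section \<open>Path metrics with constant edge length\<close>

text \<open>Geodesics may traverse edges in either direction. Walks are treated as relation powers
  of this symmetric closure, with the number of edges as exponent.\<close>

abbreviation sym_arcs :: "('a \<times> 'a) set \<Rightarrow> ('a \<times> 'a) set" where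
  "sym_arcs A \<equiv> A \<union> A\<inverse>"

lemma sym_arcs_relpow_sym:
  assumes "(x, y) \<in> sym_arcs A ^^ m"
  shows "(y, x) \<in> sym_arcs A ^^ m"
  using assms
proof (induction m arbitrary: y)
  case (Suc m)
  then obtain z where "(x, z) \<in> sym_arcs A ^^ m" "(z, y) \<in> sym_arcs A" by auto
  with Suc.IH have "(z, x) \<in> sym_arcs A ^^ m" "(y, z) \<in> sym_arcs A" by auto
  then show ?case by (rule relpow_Suc_I2[rotated])
qed auto

lemma arcs_ends_mk_symmetric:
  "parcs (mk_symmetric (with_proj D)) = sym_arcs (parcs D)"
  by (auto simp: parcs_mk_symmetric)

lemma vwalk_imp_relpow:
  assumes "vwalk p (with_proj (mk_symmetric (with_proj D)))"
  shows "(hd p, last p) \<in> sym_arcs (parcs D) ^^ (length p - 1)"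
  using assms
proof (induction p rule: vwalk_induct)
  case (Cons u v es)
  from Cons(1) have "(u, v) \<in> sym_arcs (parcs D)"
    by (simp only: with_proj_simps arcs_ends_mk_symmetric)
  with Cons(2) have "(u, last (v # es)) \<in> sym_arcs (parcs D) ^^ Suc (length es)"
    by (intro relpow_Suc_I2) auto
  then show ?case by simp
qed auto

lemma relpow_imp_vwalk:
  assumes "(x, y) \<in> sym_arcs (parcs D) ^^ m" and "x \<in> pverts D"
    and wf: "parcs D \<subseteq> pverts D \<times> pverts D"
  shows "\<exists>p. vwalk p (with_proj (mk_symmetric (with_proj D))) \<and> hd p = x \<and> last p = y \<and>
    length p = Suc m"
  using assms(1,2)
proof (induction m arbitrary: x)
  case 0
  then show ?case by (intro exI[of _ "[x]"]) (auto simp: vwalk_def)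
next
  case (Suc m)
  from Suc.prems(1) obtain z where z: "(x, z) \<in> sym_arcs (parcs D)" "(z, y) \<in> sym_arcs (parcs D) ^^ m"
    by (rule relpow_Suc_E2)
  with wf have "z \<in> pverts D" by auto
  with Suc.IH[OF z(2)] obtain p where p: "vwalk p (with_proj (mk_symmetric (with_proj D)))"
    "hd p = z" "last p = y" "length p = Suc m" by blast
  have "p \<noteq> []" using p(4) by auto
  have "vwalk (x # p) (with_proj (mk_symmetric (with_proj D)))"
    using p(1,2) z(1) Suc.prems(2) wf
    by (intro vwalk_consI) (simp_all only: with_proj_simps arcs_ends_mk_symmetric pverts_mk_symmetric)
  then show ?case using p \<open>p \<noteq> []\<close> by (intro exI[of _ "x # p"]) auto
qed

lemma edge_len_sym_arcs:
  assumes "Metric_space X d" and "\<forall>e\<in>A. edge_len d e = c" and "(x, y) \<in> sym_arcs A"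
  shows "d x y = c"
proof -
  interpret Metric_space X d by fact
  show ?thesis using assms(2,3) commute[of x y] by auto
qed

lemma vwalk_length_sum:
  assumes "vwalk p (with_proj (mk_symmetric (with_proj D)))"
    and "\<forall>(x, y) \<in> sym_arcs (parcs D). d x y = c"
  shows "(\<Sum>a\<leftarrow>vwalk_arcs p. edge_len d a) = real (length p - 1) * c"
proof -
  have "edge_len d a = c" if "a \<in> set (vwalk_arcs p)" for a
  proof -
    have "a \<in> sym_arcs (parcs D)"
      using that assms(1) unfolding vwalk_def
      by (auto simp only: with_proj_simps arcs_ends_mk_symmetric)
    then show ?thesis using assms(2) by (cases a) auto
  qed
  then have "map (edge_len d) (vwalk_arcs p) = map (\<lambda>_. c) (vwalk_arcs p)" by simp
  moreover have "sum_list (map (\<lambda>_. c) (vwalk_arcs p)) = real (length p - 1) * c"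
    using vwalk_length_simp[of p, unfolded vwalk_length_def] by (simp add: sum_list_triv)
  ultimately show ?thesis by (simp only:)
qed

lemma metric_le_relpow:
  assumes "Metric_space X d" and "\<forall>e\<in>A. edge_len d e = c" and "A \<subseteq> X \<times> X"
    and "(x, y) \<in> sym_arcs A ^^ m" and "x \<in> X"
  shows "d x y \<le> real m * c \<and> y \<in> X"
  using assms(4)
proof (induction m arbitrary: y)
  case 0
  interpret Metric_space X d by fact
  from 0 show ?case using assms(5) by simp
next
  case (Suc m)
  then obtain z where z: "(x, z) \<in> sym_arcs A ^^ m" "(z, y) \<in> sym_arcs A" by auto
  interpret Metric_space X d by fact
  from z(2) assms(3) have yz: "y \<in> X" "z \<in> X" by auto
  have "d x y \<le> d x z + d z y" using yz assms(5) by (intro triangle)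
  moreover have "d z y = c" using edge_len_sym_arcs[OF assms(1,2) z(2)] .
  moreover have "d x z \<le> real m * c" using Suc.IH[OF z(1)] by simp
  ultimately show ?case using yz by (simp add: algebra_simps)
qed

text \<open>When all edges have length \<open>c\<close>, the sum along a geodesic only counts its
  edges.\<close>

lemma geodesic_metric_relpow:
  assumes "geodesic_metric D d" and "\<forall>e\<in>parcs D. edge_len d e = c"
    and "x \<in> pverts D" "y \<in> pverts D"
  shows "\<exists>m. (x, y) \<in> sym_arcs (parcs D) ^^ m \<and> d x y = real m * c"
proof -
  from assms(1) have ms: "Metric_space (pverts D) d" by (simp add: geodesic_metric_def)
  from assms obtain p where p: "vwalk p (with_proj (mk_symmetric (with_proj D)))"
    "hd p = x" "last p = y" "d x y = (\<Sum>a\<leftarrow>vwalk_arcs p. edge_len d a)"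
    unfolding geodesic_metric_def by blast
  have "d x y = real (length p - 1) * c"
    unfolding p(4) using edge_len_sym_arcs[OF ms assms(2)] by (intro vwalk_length_sum[OF p(1)]) blast
  then show ?thesis using vwalk_imp_relpow[OF p(1)] p(2,3) by auto
qed

text \<open>The combinatorial distance of the undirected graph. The \<open>LEAST\<close> is
  meaningful only for pairs joined by a walk.\<close>

definition graph_dist :: "('a \<times> 'a) set \<Rightarrow> 'a \<Rightarrow> 'a \<Rightarrow> nat" where
  "graph_dist A x y = (LEAST m. (x, y) \<in> sym_arcs A ^^ m)"

lemma graph_dist_relpow:
  "(x, y) \<in> (sym_arcs A)\<^sup>* \<Longrightarrow> (x, y) \<in> sym_arcs A ^^ graph_dist A x y"
  unfolding graph_dist_def by (auto simp: rtrancl_power intro: LeastI)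

lemma graph_dist_le:
  "(x, y) \<in> sym_arcs A ^^ m \<Longrightarrow> graph_dist A x y \<le> m"
  unfolding graph_dist_def by (rule Least_le)

text \<open>A geodesic is a walk, hence no shorter than a shortest one; the triangle inequality
  along a shortest walk gives the other bound.\<close>

lemma geodesic_metric_eq_graph_dist:
  assumes "geodesic_metric D d" and "\<forall>e\<in>parcs D. edge_len d e = c" and "c > 0"
    and "parcs D \<subseteq> pverts D \<times> pverts D" and "x \<in> pverts D" "y \<in> pverts D"
  shows "d x y = real (graph_dist (parcs D) x y) * c"
proof -
  from assms(1) have ms: "Metric_space (pverts D) d" by (simp add: geodesic_metric_def)
  obtain m where m: "(x, y) \<in> sym_arcs (parcs D) ^^ m" "d x y = real m * c"
    using geodesic_metric_relpow[OF assms(1,2,5,6)] by blast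
  from m(1) have "(x, y) \<in> (sym_arcs (parcs D))\<^sup>*" by (rule relpow_imp_rtrancl)
  then have "d x y \<le> real (graph_dist (parcs D) x y) * c"
    using metric_le_relpow[OF ms assms(2,4) graph_dist_relpow assms(5)] by blast
  moreover have "real (graph_dist (parcs D) x y) * c \<le> real m * c"
    using graph_dist_le[OF m(1)] \<open>c > 0\<close> by simp
  ultimately show ?thesis using m(2) by simp
qed

text \<open>Gives access to the \<open>THE\<close> in \<open>oslash_metric\<close>. The witness is
  \<open>c\<close> times \<open>graph_dist\<close>, extended by zero; uniqueness on the vertices is
  \<open>geodesic_metric_eq_graph_dist\<close>.\<close>

lemma ex1_path_metric:
  fixes D :: "'a pair_pre_digraph"
  assumes wf: "parcs D \<subseteq> pverts D \<times> pverts D"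
    and loopfree: "\<And>x. (x, x) \<notin> parcs D"
    and conn: "\<And>x y. x \<in> pverts D \<Longrightarrow> y \<in> pverts D \<Longrightarrow> (x, y) \<in> (sym_arcs (parcs D))\<^sup>*"
    and "c > 0"
  shows "\<exists>!d. geodesic_metric D d \<and> (\<forall>e\<in>parcs D. edge_len d e = c) \<and>
    (\<forall>x y. x \<notin> pverts D \<or> y \<notin> pverts D \<longrightarrow> d x y = 0)"
proof (rule ex_ex1I)
  define g where "g = graph_dist (parcs D)"
  define d where "d x y = (if x \<in> pverts D \<and> y \<in> pverts D then real (g x y) * c else 0)" for x y
  have g: "(x, y) \<in> sym_arcs (parcs D) ^^ g x y" if "x \<in> pverts D" "y \<in> pverts D" for x y
    unfolding g_def using graph_dist_relpow[OF conn[OF that]] .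
  have g_le: "g x y \<le> m" if "(x, y) \<in> sym_arcs (parcs D) ^^ m" for x y m
    unfolding g_def using graph_dist_le[OF that] .
  have g_sym: "g x y = g y x" if "x \<in> pverts D" "y \<in> pverts D" for x y
    using g_le[OF sym_arcs_relpow_sym[OF g[OF that]]]
      g_le[OF sym_arcs_relpow_sym[OF g[OF that(2,1)]]] by simp
  have g_tri: "g x z \<le> g x y + g y z" if "x \<in> pverts D" "y \<in> pverts D" "z \<in> pverts D" for x y z
    using g[OF that(1,2)] g[OF that(2,3)] by (intro g_le) (auto simp: relpow_add)
  have g0: "g x x = 0" for x using g_le[of x x 0] by simp
  have eq: "x = y" if "x \<in> pverts D" "y \<in> pverts D" "g x y = 0" for x y
    using g[OF that(1,2)] that(3) by simp
  \<comment> \<open>The ends of an edge differ because there are no loops, so their distance is one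
    step and not zero.\<close>
  have edge: "d x y = c" if "(x, y) \<in> sym_arcs (parcs D)" for x y
  proof -
    from that have xy: "x \<in> pverts D" "y \<in> pverts D" "x \<noteq> y" using wf loopfree by auto
    with eq have "g x y \<noteq> 0" by blast
    moreover have "g x y \<le> 1" using that by (intro g_le) auto
    ultimately show ?thesis using xy by (simp add: d_def)
  qed
  have ms: "Metric_space (pverts D) d"
  proof
    show "0 \<le> d x y" for x y using \<open>c > 0\<close> by (simp add: d_def)
    show "d x y = d y x" for x y using g_sym by (auto simp: d_def)
    show "(d x y = 0) = (x = y)" if "x \<in> pverts D" "y \<in> pverts D" for x y
      using that \<open>c > 0\<close> eq g0 by (auto simp: d_def)
    show "d x z \<le> d x y + d y z"
      if "x \<in> pverts D" "y \<in> pverts D" "z \<in> pverts D" for x y z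
    proof -
      have "real (g x z) \<le> real (g x y) + real (g y z)" using g_tri[OF that] by linarith
      then show ?thesis using that \<open>c > 0\<close> by (simp add: d_def flip: distrib_right)
    qed
  qed
  have "geodesic_metric D d"
    unfolding geodesic_metric_def
  proof (intro conjI ballI ms)
    fix x y assume xy: "x \<in> pverts D" "y \<in> pverts D"
    obtain p where p: "vwalk p (with_proj (mk_symmetric (with_proj D)))" "hd p = x" "last p = y"
      "length p = Suc (g x y)"
      using relpow_imp_vwalk[OF g[OF xy] xy(1) wf] by blast
    have "(\<Sum>a\<leftarrow>vwalk_arcs p. edge_len d a) = real (g x y) * c"
      using vwalk_length_sum[OF p(1), of d c] edge p(4) by auto
    then show "\<exists>p. vwalk p (with_proj (mk_symmetric (with_proj D))) \<and> hd p = x \<and> last p = y \<and>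
       d x y = (\<Sum>a\<leftarrow>vwalk_arcs p. edge_len d a)"
      using p xy by (intro exI[of _ p]) (auto simp: d_def)
  qed
  then show "\<exists>d. geodesic_metric D d \<and> (\<forall>e\<in>parcs D. edge_len d e = c) \<and>
    (\<forall>x y. x \<notin> pverts D \<or> y \<notin> pverts D \<longrightarrow> d x y = 0)"
    using edge by (intro exI[of _ d]) (auto simp: d_def)
next
  fix d d'
  assume d: "geodesic_metric D d \<and> (\<forall>e\<in>parcs D. edge_len d e = c) \<and>
      (\<forall>x y. x \<notin> pverts D \<or> y \<notin> pverts D \<longrightarrow> d x y = 0)"
    and d': "geodesic_metric D d' \<and> (\<forall>e\<in>parcs D. edge_len d' e = c) \<and>
      (\<forall>x y. x \<notin> pverts D \<or> y \<notin> pverts D \<longrightarrow> d' x y = 0)"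
  show "d = d'"
  proof (intro ext)
    fix x y
    show "d x y = d' x y"
    proof (cases "x \<in> pverts D \<and> y \<in> pverts D")
      case True
      then show ?thesis
        using geodesic_metric_eq_graph_dist[OF _ _ \<open>c > 0\<close> wf, of d x y]
          geodesic_metric_eq_graph_dist[OF _ _ \<open>c > 0\<close> wf, of d' x y] d d' by simp
    next
      case False
      then show ?thesis using d d' by auto
    qed
  qed
qed

text \<open>Telescoping along a walk: increments over single edges control the Lipschitz
  constant.\<close>

lemma relpow_diff_le:
  fixes f :: "'a \<Rightarrow> real"
  assumes "\<forall>(x, y) \<in> A. \<bar>f x - f y\<bar> \<le> c" and "(x, y) \<in> sym_arcs A ^^ m"
  shows "\<bar>f x - f y\<bar> \<le> real m * c"
  using assms(2)
proof (induction m arbitrary: y)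
  case (Suc m)
  then obtain z where z: "(x, z) \<in> sym_arcs A ^^ m" "(z, y) \<in> sym_arcs A" by auto
  have "\<bar>f z - f y\<bar> \<le> c" using z(2) assms(1) by (auto simp: abs_minus_commute)
  with Suc.IH[OF z(1)] show ?case by (simp add: algebra_simps)
qed auto

section \<open>Gluing copies of a graph along the edges of another\<close>

text \<open>The invariants carried through the induction over powers; connectivity disregards
  orientation.\<close>

definition wf_graph :: "'a st_digraph \<Rightarrow> bool" where
  "wf_graph H \<longleftrightarrow> finite (V H) \<and> E H \<subseteq> V H \<times> V H \<and> (\<forall>x. (x, x) \<notin> E H) \<and> E H \<noteq> {} \<and>
     (\<forall>x \<in> V H. \<forall>y \<in> V H. (x, y) \<in> (sym_arcs (E H))\<^sup>*)"

lemma wf_graph_finite_arcs: "wf_graph H \<Longrightarrow> finite (E H)"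
  unfolding wf_graph_def by (meson finite_SigmaI finite_subset)

lemma wf_graph_arcD: "wf_graph H \<Longrightarrow> e \<in> E H \<Longrightarrow> fst e \<in> V H \<and> snd e \<in> V H \<and> fst e \<noteq> snd e"
  unfolding wf_graph_def by (cases e) auto

text \<open>An edge is not a loop, so a second vertex exists, and a path to it leaves
  \<open>x\<close> along some edge. This makes the vertex measure positive at every vertex.\<close>

lemma wf_graph_incident:
  assumes "wf_graph H" "x \<in> V H"
  shows "\<exists>e \<in> E H. x \<in> {fst e, snd e}"
proof -
  from assms(1) obtain e where "e \<in> E H" unfolding wf_graph_def by blast
  then obtain y where y: "y \<in> V H" "y \<noteq> x" using wf_graph_arcD[OF assms(1)] by metis
  with assms have "(x, y) \<in> (sym_arcs (E H))\<^sup>*" unfolding wf_graph_def by blast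
  with y(2) obtain z where "(x, z) \<in> sym_arcs (E H)" by (metis converse_rtranclE)
  then have "(x, z) \<in> E H \<or> (z, x) \<in> E H" by auto
  then show ?thesis by (metis fst_conv snd_conv insertCI)
qed

lemma rtrancl_image:
  assumes "(x, y) \<in> R\<^sup>*" and "\<And>a b. (a, b) \<in> R \<Longrightarrow> (h a, h b) \<in> S\<^sup>*"
  shows "(h x, h y) \<in> S\<^sup>*"
  using assms(1) by (induction) (auto intro: rtrancl_trans assms(2))

lemma relpow_image:
  assumes "(x, y) \<in> R ^^ m" and "\<And>a b. (a, b) \<in> R \<Longrightarrow> (h a, h b) \<in> S"
  shows "(h x, h y) \<in> S ^^ m"
  using assms(1) by (induction m arbitrary: y) (auto intro: assms(2))

lemma wf_graph_rename:
  assumes "wf_graph H" "inj_on h (V H)"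
  shows "wf_graph (rename_graph h H)"
proof -
  have "(h x, h y) \<in> (sym_arcs (map_prod h h ` E H))\<^sup>*" if "x \<in> V H" "y \<in> V H" for x y
  proof (rule rtrancl_image[where R = "sym_arcs (E H)"])
    show "(x, y) \<in> (sym_arcs (E H))\<^sup>*" using that assms(1) unfolding wf_graph_def by blast
    show "(h a, h b) \<in> (sym_arcs (map_prod h h ` E H))\<^sup>*" if "(a, b) \<in> sym_arcs (E H)" for a b
      using that by (intro r_into_rtrancl) (auto intro: rev_image_eqI)
  qed
  moreover have "(z, z) \<notin> map_prod h h ` E H" for z
  proof
    assume "(z, z) \<in> map_prod h h ` E H"
    then obtain a b where e: "(a, b) \<in> E H" "h a = h b" by auto
    then show False using wf_graph_arcD[OF assms(1) e(1)] assms(2) by (auto dest: inj_onD)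
  qed
  moreover have "map_prod h h ` E H \<subseteq> h ` V H \<times> h ` V H"
    using assms(1) unfolding wf_graph_def by auto
  ultimately show ?thesis
    using assms(1) unfolding wf_graph_def rename_graph_def by simp
qed

text \<open>By \<open>interior\<close> every edge has an endpoint other than source and sink. Such a
  vertex is never identified with another one, so it records the copy to which the edge
  belongs.\<close>

locale base_graph =
  fixes G :: "'b st_digraph"
  assumes wf: "wf_graph G"
    and source_in: "source G \<in> V G" and sink_in: "sink G \<in> V G"
    and source_neq_sink: "source G \<noteq> sink G"
    and interior: "e \<in> E G \<Longrightarrow> fst e \<notin> {source G, sink G} \<or> snd e \<notin> {source G, sink G}"
begin

lemma base_arc_ends: "f \<in> E G \<Longrightarrow> fst f \<in> V G \<and> snd f \<in> V G"
  using wf_graph_arcD[OF wf] by blast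

definition glued :: "'a \<times> 'a \<Rightarrow> 'b \<Rightarrow> 'a \<times> 'a \<Rightarrow> 'b \<Rightarrow> bool" where
  "glued e u e' u' \<longleftrightarrow> (e, u) = (e', u') \<or>
     u \<in> {source G, sink G} \<and> u' \<in> {source G, sink G} \<and>
     oslash_endpoint G e u = oslash_endpoint G e' u'"

definition glue_edge :: "('a \<times> 'a \<Rightarrow> 'b \<Rightarrow> 'c) \<Rightarrow> ('a \<times> 'a) \<times> ('b \<times> 'b) \<Rightarrow> 'c \<times> 'c" where
  "glue_edge q p = (q (fst p) (fst (snd p)), q (fst p) (snd (snd p)))"

text \<open>\<open>q e u\<close> is the name of the class of \<open>(e, u)\<close> in
  \<open>K\<close>. Prescribing only when two names agree covers \<open>oslash\<close> and its
  renamed version at once, in any vertex type.\<close>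

definition glue_product :: "'a st_digraph \<Rightarrow> ('a \<times> 'a \<Rightarrow> 'b \<Rightarrow> 'c) \<Rightarrow> 'c st_digraph \<Rightarrow> bool" where
  "glue_product H q K \<longleftrightarrow>
     V K = (\<lambda>(e, u). q e u) ` (E H \<times> V G) \<and> E K = glue_edge q ` (E H \<times> E G) \<and>
     (\<forall>e \<in> E H. \<forall>e' \<in> E H. \<forall>u \<in> V G. \<forall>u' \<in> V G. q e u = q e' u' \<longleftrightarrow> glued e u e' u')"

lemma glue_productD:
  assumes "glue_product H q K"
  shows "V K = (\<lambda>(e, u). q e u) ` (E H \<times> V G)" "E K = glue_edge q ` (E H \<times> E G)"
    "\<And>e e' u u'. \<lbrakk>e \<in> E H; e' \<in> E H; u \<in> V G; u' \<in> V G\<rbrakk> \<Longrightarrow> q e u = q e' u' \<longleftrightarrow> glued e u e' u'"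
  using assms unfolding glue_product_def by auto

lemma equiv_oslash_rel: "equiv (E H \<times> V G) (oslash_rel H G)"
proof (rule equivI)
  show "oslash_rel H G \<subseteq> (E H \<times> V G) \<times> (E H \<times> V G)" by (auto simp: oslash_rel_def)
  show "refl_on (E H \<times> V G) (oslash_rel H G)" by (auto simp: oslash_rel_def refl_on_def)
  show "sym (oslash_rel H G)" by (auto simp: oslash_rel_def sym_def)
  show "trans (oslash_rel H G)" by (rule transI) (auto simp: oslash_rel_def)
qed

lemma glue_product_oslash: "glue_product H (oslash_vertex H G) (oslash H G)"
  unfolding glue_product_def
proof (intro conjI ballI)
  show "V (oslash H G) = (\<lambda>(e, u). oslash_vertex H G e u) ` (E H \<times> V G)"
    by (auto simp: oslash_def quotient_def oslash_vertex_def)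
  show "E (oslash H G) = glue_edge (oslash_vertex H G) ` (E H \<times> E G)"
  proof -
    have "E (oslash H G) = (\<lambda>(e, f). oslash_edge H G e f) ` (E H \<times> E G)" by (auto simp: oslash_def)
    also have "(\<lambda>(e, f). oslash_edge H G e f) = glue_edge (oslash_vertex H G)"
      by (auto simp: fun_eq_iff oslash_edge_def glue_edge_def)
    finally show ?thesis .
  qed
  fix e e' u u' assume "e \<in> E H" "e' \<in> E H" "u \<in> V G" "u' \<in> V G"
  then show "oslash_vertex H G e u = oslash_vertex H G e' u' \<longleftrightarrow> glued e u e' u'"
    unfolding oslash_vertex_def
    by (subst eq_equiv_class_iff[OF equiv_oslash_rel]) (auto simp: glued_def oslash_rel_def)
qed

lemma glue_product_rename:
  assumes "glue_product H q K" "inj_on h (V K)"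
  shows "glue_product H (\<lambda>e u. h (q e u)) (rename_graph h K)"
proof -
  note g = glue_productD[OF assms(1)]
  have in_V: "q e u \<in> V K" if "e \<in> E H" "u \<in> V G" for e u using that unfolding g(1) by auto
  show ?thesis
    unfolding glue_product_def
  proof (intro conjI ballI)
    show "V (rename_graph h K) = (\<lambda>(e, u). h (q e u)) ` (E H \<times> V G)"
      by (simp add: rename_graph_def g(1) image_image case_prod_unfold)
    show "E (rename_graph h K) = glue_edge (\<lambda>e u. h (q e u)) ` (E H \<times> E G)"
      by (simp add: rename_graph_def g(2) image_image glue_edge_def)
    fix e e' u u' assume *: "e \<in> E H" "e' \<in> E H" "u \<in> V G" "u' \<in> V G"
    then have "h (q e u) = h (q e' u') \<longleftrightarrow> q e u = q e' u'"
      using inj_on_eq_iff[OF assms(2)] in_V by blast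
    then show "h (q e u) = h (q e' u') \<longleftrightarrow> glued e u e' u'" using g(3)[OF *] by simp
  qed
qed

section \<open>Connectivity, edges and functions of a glued product\<close>

context
  fixes H :: "'a st_digraph" and q :: "'a \<times> 'a \<Rightarrow> 'b \<Rightarrow> 'c" and K :: "'c st_digraph"
  assumes wfH: "wf_graph H" and glue: "glue_product H q K"
begin

lemma glue_copy_connected:
  assumes "e \<in> E H" "u \<in> V G" "v \<in> V G"
  shows "(q e u, q e v) \<in> (sym_arcs (E K))\<^sup>*"
proof (rule rtrancl_image[where h = "q e"])
  show "(u, v) \<in> (sym_arcs (E G))\<^sup>*" using wf assms unfolding wf_graph_def by blast
  show "(q e a, q e b) \<in> (sym_arcs (E K))\<^sup>*" if "(a, b) \<in> sym_arcs (E G)" for a b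
  proof -
    have "(q e c, q e d) \<in> E K" if "(c, d) \<in> E G" for c d
      unfolding glue_productD(2)[OF glue]
      by (rule image_eqI[of _ _ "(e, (c, d))"]) (use that assms(1) in \<open>auto simp: glue_edge_def\<close>)
    then show ?thesis using that by (intro r_into_rtrancl) auto
  qed
qed

text \<open>A walk in \<open>H\<close> lifts to \<open>K\<close>: each of its edges is replaced by a
  path across the corresponding copy of \<open>G\<close>, and consecutive copies are glued at the
  vertices of \<open>H\<close>.\<close>

lemma glue_endpoints_connected:
  assumes "e \<in> E H" "(fst e, y) \<in> (sym_arcs (E H))\<^sup>*" "e' \<in> E H" "u \<in> {source G, sink G}"
    "oslash_endpoint G e' u = y"
  shows "(q e (source G), q e' u) \<in> (sym_arcs (E K))\<^sup>*"
  using assms(2-5)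
proof (induction arbitrary: e' u)
  case base
  then have "q e (source G) = q e' u"
    using assms(1) source_in sink_in
    by (subst glue_productD(3)[OF glue]) (auto simp: glued_def oslash_endpoint_def)
  then show ?case by simp
next
  case (step y z)
  have ends: "source G \<in> V G" "sink G \<in> V G" using source_in sink_in by auto
  \<comment> \<open>\<open>a\<close> is the edge between \<open>y\<close> and \<open>z\<close> in
    its actual direction; \<open>v\<close> and \<open>w\<close> are the terminals of its copy that
    lie at \<open>y\<close> and \<open>z\<close>.\<close>
  obtain a v w where a: "a \<in> E H" "v \<in> {source G, sink G}" "w \<in> {source G, sink G}"
    "oslash_endpoint G a v = y" "oslash_endpoint G a w = z"
  proof (cases "(y, z) \<in> E H")
    case True
    then show ?thesis
      using that[of "(y, z)" "source G" "sink G"] source_neq_sink by (auto simp: oslash_endpoint_def)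
  next
    case False
    then have "(z, y) \<in> E H" using step.hyps(2) by auto
    then show ?thesis
      using that[of "(z, y)" "sink G" "source G"] source_neq_sink by (auto simp: oslash_endpoint_def)
  qed
  have vw: "v \<in> V G" "w \<in> V G" "u \<in> V G" using a ends step.prems(2) by auto
  have "(q e (source G), q a v) \<in> (sym_arcs (E K))\<^sup>*" using step.IH a by blast
  also have "(q a v, q a w) \<in> (sym_arcs (E K))\<^sup>*" using glue_copy_connected a(1) vw by blast
  also have "q a w = q e' u"
    using a step.prems vw by (subst glue_productD(3)[OF glue]) (auto simp: glued_def)
  finally show ?case .
qed

lemma wf_graph_glue: "wf_graph K"
  unfolding wf_graph_def
proof (intro conjI ballI allI)
  note g = glue_productD[OF glue]
  show "finite (V K)" unfolding g(1)
    using wf_graph_finite_arcs[OF wfH] wf unfolding wf_graph_def by auto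
  show "E K \<subseteq> V K \<times> V K"
    unfolding g(1,2) using base_arc_ends by (fastforce simp: glue_edge_def)
  show "E K \<noteq> {}" using wfH wf unfolding g(2) wf_graph_def by auto
  show "(x, x) \<notin> E K" for x
  proof
    assume "(x, x) \<in> E K"
    then obtain e f where ef: "e \<in> E H" "f \<in> E G" "q e (fst f) = q e (snd f)"
      unfolding g(2) by (auto simp: glue_edge_def)
    then have "glued e (fst f) e (snd f)" using g(3) base_arc_ends by blast
    then show False
      using wf_graph_arcD[OF wf ef(2)] interior[OF ef(2)] by (auto simp: glued_def)
  qed
  fix x y assume "x \<in> V K" "y \<in> V K"
  then obtain e u e' u' where x: "e \<in> E H" "u \<in> V G" "x = q e u" and y: "e' \<in> E H" "u' \<in> V G" "y = q e' u'"
    unfolding g(1) by auto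
  \<comment> \<open>First to the source of the copy containing \<open>x\<close>, then across copies
    over a walk in \<open>H\<close>, then inside the copy containing \<open>y\<close>.\<close>
  have "(x, q e (source G)) \<in> (sym_arcs (E K))\<^sup>*"
    unfolding x(3) using glue_copy_connected x(1,2) source_in by blast
  also have "(q e (source G), q e' (source G)) \<in> (sym_arcs (E K))\<^sup>*"
  proof (rule glue_endpoints_connected[OF x(1) _ y(1)])
    show "(fst e, fst e') \<in> (sym_arcs (E H))\<^sup>*"
      using wfH wf_graph_arcD[OF wfH] x(1) y(1) unfolding wf_graph_def by blast
  qed (auto simp: oslash_endpoint_def)
  also have "(q e' (source G), y) \<in> (sym_arcs (E K))\<^sup>*"
    unfolding y(3) using glue_copy_connected y(1,2) source_in by blast
  finally show "(x, y) \<in> (sym_arcs (E K))\<^sup>*" .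
qed

text \<open>A non-terminal endpoint determines the edge of \<open>H\<close> and its own position in
  the copy. The other endpoint is then determined as well, since the two ends of an edge of
  \<open>H\<close> are distinct.\<close>

lemma inj_on_glue_edge: "inj_on (glue_edge q) (E H \<times> E G)"
proof (rule inj_onI)
  fix x y assume x: "x \<in> E H \<times> E G" and y: "y \<in> E H \<times> E G" and xy: "glue_edge q x = glue_edge q y"
  obtain e1 e2 f1 f2 e1' e2' f1' f2' where
    x_eq: "x = ((e1, e2), (f1, f2))" and y_eq: "y = ((e1', e2'), (f1', f2'))"
    by (metis prod.exhaust)
  have e: "(e1, e2) \<in> E H" "(e1', e2') \<in> E H" and f: "(f1, f2) \<in> E G" "(f1', f2') \<in> E G"
    and eq: "glue_edge q ((e1, e2), f1, f2) = glue_edge q ((e1', e2'), f1', f2')"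
    using x y xy unfolding x_eq y_eq by auto
  have V: "f1 \<in> V G" "f2 \<in> V G" "f1' \<in> V G" "f2' \<in> V G" using f base_arc_ends by fastforce+
  have g1: "glued (e1, e2) f1 (e1', e2') f1'" and g2: "glued (e1, e2) f2 (e1', e2') f2'"
    using eq glue_productD(3)[OF glue e V(1,3)] glue_productD(3)[OF glue e V(2,4)]
    by (auto simp: glue_edge_def)
  have "e1 \<noteq> e2" using wf_graph_arcD[OF wfH e(1)] by simp
  then show "x = y"
    unfolding x_eq y_eq using g1 g2 interior[OF f(1)] interior[OF f(2)] source_neq_sink
    by (auto simp: glued_def oslash_endpoint_def split: if_splits)
qed

lemma sum_glue:
  fixes F :: "'c \<times> 'c \<Rightarrow> 'r::comm_monoid_add"
  shows "(\<Sum>a\<in>E K. F a) = (\<Sum>e\<in>E H. \<Sum>f\<in>E G. F (q e (fst f), q e (snd f)))"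
  unfolding glue_productD(2)[OF glue] sum.reindex[OF inj_on_glue_edge]
  by (simp add: sum.cartesian_product glue_edge_def case_prod_unfold o_def)

lemma card_glue: "card (E K) = card (E H) * card (E G)"
  unfolding glue_productD(2)[OF glue] card_image[OF inj_on_glue_edge] by (rule card_cartesian_product)

text \<open>Injectivity of \<open>glue_edge q\<close> keeps products of uniform measures uniform, so
  integrals over powers become plain sums over edges.\<close>

lemma pmf_glue:
  "map_pmf (glue_edge q) (pair_pmf (pmf_of_set (E H)) (pmf_of_set (E G))) = pmf_of_set (E K)"
proof -
  have ne: "E H \<noteq> {}" "E G \<noteq> {}" "finite (E H)" "finite (E G)"
    using wf wfH wf_graph_finite_arcs by (auto simp: wf_graph_def)
  have "pair_pmf (pmf_of_set (E H)) (pmf_of_set (E G)) = pmf_of_set (E H \<times> E G)"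
  proof (rule pmf_eqI)
    fix x show "pmf (pair_pmf (pmf_of_set (E H)) (pmf_of_set (E G))) x = pmf (pmf_of_set (E H \<times> E G)) x"
      using ne by (cases x) (simp add: pmf_pair card_cartesian_product indicator_times Sigma_empty_iff)
  qed
  then show ?thesis
    using ne inj_on_glue_edge by (simp add: map_pmf_of_set_inj glue_productD(2)[OF glue])
qed

text \<open>Evaluates \<open>g\<close> at a chosen representative. \<open>glue_fun_apply\<close>
  reduces independence of the choice to agreement at the terminals.\<close>

definition glue_fun :: "('a \<times> 'a \<Rightarrow> 'b \<Rightarrow> real) \<Rightarrow> 'c \<Rightarrow> real" where
  "glue_fun g x = (let p = (SOME p. p \<in> E H \<times> V G \<and> q (fst p) (snd p) = x) in g (fst p) (snd p))"

lemma glue_fun_apply: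
  assumes "\<And>e e' u u'. \<lbrakk>e \<in> E H; e' \<in> E H; u \<in> {source G, sink G}; u' \<in> {source G, sink G};
      oslash_endpoint G e u = oslash_endpoint G e' u'\<rbrakk> \<Longrightarrow> g e u = g e' u'"
    and "e \<in> E H" "u \<in> V G"
  shows "glue_fun g (q e u) = g e u"
proof -
  define p where "p = (SOME p. p \<in> E H \<times> V G \<and> q (fst p) (snd p) = q e u)"
  have "p \<in> E H \<times> V G \<and> q (fst p) (snd p) = q e u"
    unfolding p_def by (rule someI[of _ "(e, u)"]) (use assms in auto)
  moreover from this have "glued (fst p) (snd p) e u"
    using glue_productD(3)[OF glue, of "fst p" e "snd p" u] assms(2,3) by (simp add: mem_Times_iff)
  ultimately have "g (fst p) (snd p) = g e u"
    using assms(1)[of "fst p" e "snd p" u] assms(2) by (auto simp: glued_def mem_Times_iff)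
  then show ?thesis unfolding glue_fun_def Let_def p_def[symmetric] by simp
qed

end
end

section \<open>Walsh functions\<close>

text \<open>The rows of the Sylvester-Hadamard matrix: each \<open>h\<close> yields the doubled rows
  \<open>(h, h)\<close> and \<open>(h, -h)\<close>. With \<open>sorted_wrt\<close>, orthogonality
  concerns different positions of the list.\<close>

lemma walsh_functions_nat:
  "\<exists>hs :: (nat \<Rightarrow> real) list. length hs = 2 ^ j \<and>
     (\<forall>h\<in>set hs. \<forall>x. \<bar>h x\<bar> = (if x < 2 ^ j then 1 else 0)) \<and>
     sorted_wrt (\<lambda>h h'. (\<Sum>x<2^j. h x * h' x) = 0) hs"
proof (induction j)
  case 0
  show ?case by (rule exI[of _ "[\<lambda>x. if x = 0 then 1 else 0]"]) auto
next
  case (Suc j)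
  define N where "N = (2::nat) ^ j"
  obtain hs :: "(nat \<Rightarrow> real) list" where len: "length hs = N"
    and abs: "\<And>h x. h \<in> set hs \<Longrightarrow> \<bar>h x\<bar> = (if x < N then 1 else 0)"
    and orth: "sorted_wrt (\<lambda>h h'. (\<Sum>x<N. h x * h' x) = 0) hs"
    using Suc.IH unfolding N_def by blast
  define ext where "ext c h x = (if x < N then h x else c * h (x - N))" for c :: real and h x
  have sum_ext: "(\<Sum>x<2 * N. ext c h x * ext c' h' x) = (1 + c * c') * (\<Sum>x<N. h x * h' x)"
    for c c' h h'
  proof -
    have "(\<Sum>x<2 * N. ext c h x * ext c' h' x)
      = (\<Sum>x<N. ext c h x * ext c' h' x) + (\<Sum>x=N..<N+N. ext c h x * ext c' h' x)"
      by (simp add: lessThan_atLeast0 sum.atLeastLessThan_concat mult_2)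
    also have "(\<Sum>x=N..<N+N. ext c h x * ext c' h' x) = (\<Sum>x<N. c * c' * (h x * h' x))"
      using sum.shift_bounds_nat_ivl[of "\<lambda>x. ext c h x * ext c' h' x" 0 N N]
      by (simp add: ext_def lessThan_atLeast0 mult_ac)
    also have "(\<Sum>x<N. ext c h x * ext c' h' x) = (\<Sum>x<N. h x * h' x)" by (simp add: ext_def)
    finally show ?thesis by (simp add: sum_distrib_left sum.distrib algebra_simps)
  qed
  \<comment> \<open>Rows with the same sign inherit orthogonality from \<open>hs\<close>; for
    opposite signs the factor \<open>1 + c * c'\<close> is zero.\<close>
  have "sorted_wrt (\<lambda>h h'. (\<Sum>x<2 * N. h x * h' x) = 0) (map (ext 1) hs @ map (ext (-1)) hs)"
    unfolding sorted_wrt_append sorted_wrt_map using orth by (auto simp: sum_ext)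
  moreover have "\<bar>g x\<bar> = (if x < 2 * N then 1 else 0)"
    if g: "g \<in> set (map (ext 1) hs @ map (ext (-1)) hs)" for g x
  proof -
    from g obtain h c where "h \<in> set hs" "c = 1 \<or> c = -1" "g = ext c h" by auto
    then show ?thesis using abs[of h] by (auto simp: ext_def abs_mult)
  qed
  moreover have "length (map (ext 1) hs @ map (ext (-1)) hs) = 2 * N" using len by simp
  ultimately show ?case unfolding power_Suc N_def[symmetric] by blast
qed

lemma power_of_two_between:
  assumes "n > 0"
  shows "\<exists>j. 2 ^ j \<le> n \<and> n < 2 * (2::nat) ^ j"
  using ex_power_ivl1[of 2 n] assms by auto

text \<open>The functions have modulus 1 on \<open>2 ^ j\<close> points of \<open>A\<close> and
  vanish on the others. These are fewer than \<open>2 ^ j\<close>, which gives the factor two in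
  both bounds.\<close>

lemma walsh_functions:
  assumes "finite A" "A \<noteq> {}"
  shows "\<exists>hs :: ('a \<Rightarrow> real) list. card A \<le> 2 * length hs \<and>
     (\<forall>h\<in>set hs. (\<forall>x. \<bar>h x\<bar> \<le> 1) \<and> real (card A) \<le> 2 * (\<Sum>x\<in>A. \<bar>h x\<bar>)) \<and>
     sorted_wrt (\<lambda>h h'. (\<Sum>x\<in>A. h x * h' x) = 0) hs"
proof -
  obtain j where j: "2 ^ j \<le> card A" "card A < 2 * (2::nat) ^ j"
    using power_of_two_between[of "card A"] assms by (auto simp: card_gt_0_iff)
  obtain hs :: "(nat \<Rightarrow> real) list" where len: "length hs = 2 ^ j"
    and abs: "\<And>h x. h \<in> set hs \<Longrightarrow> \<bar>h x\<bar> = (if x < 2 ^ j then 1 else 0)"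
    and orth: "sorted_wrt (\<lambda>h h'. (\<Sum>x<2^j. h x * h' x) = 0) hs"
    using walsh_functions_nat[of j] by blast
  obtain b where b: "bij_betw b A {0..<card A}" using ex_bij_betw_finite_nat[OF assms(1)] by blast
  have sum_b: "(\<Sum>x\<in>A. F (b x)) = (\<Sum>x<2^j. F x)" if "\<And>x. x \<ge> 2 ^ j \<Longrightarrow> F x = 0"
    for F :: "nat \<Rightarrow> real"
    unfolding sum.reindex_bij_betw[OF b] using j(1) that
    by (intro sum.mono_neutral_right) auto
  have zero: "h x = 0" if "h \<in> set hs" "x \<ge> 2 ^ j" for h x using abs[OF that(1), of x] that(2) by auto
  have "real (card A) \<le> 2 * (\<Sum>x\<in>A. \<bar>h (b x)\<bar>)" if "h \<in> set hs" for h
  proof -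
    have "(\<Sum>x\<in>A. \<bar>h (b x)\<bar>) = 2 ^ j"
      using sum_b[of "\<lambda>x. \<bar>h x\<bar>"] zero[OF that] abs[OF that] by simp
    moreover have "real (card A) \<le> real (2 * 2 ^ j)" using j(2) by (intro of_nat_mono) simp
    ultimately show ?thesis by simp
  qed
  moreover have "\<bar>h x\<bar> \<le> 1" if "h \<in> set hs" for h x using abs[OF that, of x] by auto
  moreover have "sorted_wrt (\<lambda>h h'. (\<Sum>x\<in>A. h x * h' x) = 0) (map (\<lambda>h x. h (b x)) hs)"
    unfolding sorted_wrt_map
    by (rule sorted_wrt_mono_rel[OF _ orth]) (simp add: sum_b[of "\<lambda>x. _ x * _ x"] zero)
  ultimately show ?thesis
    using j(2) len by (intro exI[of _ "map (\<lambda>h x. h (b x)) hs"]) auto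
qed

section \<open>Orthogonal families\<close>

text \<open>Interpolation along the copies of the base graph does not preserve orthogonality for the
  vertex measure, but it does preserve the vanishing of all four edge correlations.\<close>

definition edge_orthogonal :: "'a st_digraph \<Rightarrow> ('a \<Rightarrow> real) \<Rightarrow> ('a \<Rightarrow> real) \<Rightarrow> bool" where
  "edge_orthogonal H f g \<longleftrightarrow>
     (\<forall>p\<in>{fst, snd}. \<forall>r\<in>{fst, snd}. (\<Sum>e\<in>E H. f (p e) * g (r e)) = 0)"

text \<open>This is \<open>2 * card (E H)\<close> times the L1 norm for the vertex measure of the
  uniform edge measure.\<close>

definition edge_abs_sum :: "'a st_digraph \<Rightarrow> ('a \<Rightarrow> real) \<Rightarrow> real" where
  "edge_abs_sum H f = (\<Sum>e\<in>E H. \<bar>f (fst e)\<bar> + \<bar>f (snd e)\<bar>)"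

lemma abs_interpolation:
  fixes a b p :: real
  assumes "a * b \<ge> 0" "0 \<le> p" "p \<le> 1"
  shows "\<bar>(1 - p) * a + p * b\<bar> = (1 - p) * \<bar>a\<bar> + p * \<bar>b\<bar>"
proof -
  have "((1 - p) * a) * (p * b) \<ge> 0"
    using assms mult_nonneg_nonneg[of "(1 - p) * p" "a * b"] by (simp add: mult_ac)
  then have "\<bar>(1 - p) * a + p * b\<bar> = \<bar>(1 - p) * a\<bar> + \<bar>p * b\<bar>"
    by (auto simp: zero_le_mult_iff)
  then show ?thesis using assms by (simp add: abs_mult)
qed

text \<open>Expanding gives nonnegative multiples of the squares and of \<open>a * b\<close>.
  Interpolation thereby keeps the edge-sign property.\<close>

lemma interpolation_same_sign:
  fixes a b p r :: real
  assumes "a * b \<ge> 0" "0 \<le> p" "p \<le> 1" "0 \<le> r" "r \<le> 1"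
  shows "((1 - p) * a + p * b) * ((1 - r) * a + r * b) \<ge> 0"
proof -
  have "((1 - p) * a + p * b) * ((1 - r) * a + r * b) =
    (1 - p) * (1 - r) * a\<^sup>2 + p * r * b\<^sup>2 + ((1 - p) * r + p * (1 - r)) * (a * b)"
    by (simp add: algebra_simps power2_eq_square)
  then show ?thesis using assms by simp
qed

lemma same_sign_diff_le:
  fixes a b :: real
  assumes "a * b \<ge> 0" "\<bar>a\<bar> \<le> c" "\<bar>b\<bar> \<le> c"
  shows "\<bar>a - b\<bar> \<le> c"
  using assms by (auto simp: zero_le_mult_iff)

text \<open>\<open>\<phi>\<close> is normalised to be bounded by 1. \<open>pi_mean\<close> is the
  contribution of reflection invariance: midpoints of image edges average to 1/2.
  \<open>phi_fst\<close> and \<open>phi_snd\<close> express the vanishing conditional expectations,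
  because \<open>\<pi> (fst f)\<close> determines the image edge.\<close>

locale collapsing_graph = base_graph G
  for G :: "'b st_digraph" +
  fixes k :: nat and \<pi> \<phi> :: "'b \<Rightarrow> real"
  assumes k: "k \<ge> 2"
    and pi_source: "\<pi> (source G) = 0" and pi_sink: "\<pi> (sink G) = 1"
    and pi_range: "u \<in> V G \<Longrightarrow> 0 \<le> \<pi> u \<and> \<pi> u \<le> 1"
    and pi_step: "f \<in> E G \<Longrightarrow> \<pi> (snd f) = \<pi> (fst f) + 1 / k"
    and pi_mean: "(\<Sum>f\<in>E G. \<pi> (fst f) + \<pi> (snd f)) = card (E G)"
    and phi_ends: "u \<in> {source G, sink G} \<Longrightarrow> \<phi> u = 0"
    and phi_le: "u \<in> V G \<Longrightarrow> \<bar>\<phi> u\<bar> \<le> 1"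
    and phi_sign: "f \<in> E G \<Longrightarrow> \<phi> (fst f) * \<phi> (snd f) \<ge> 0"
    and phi_fst: "(\<Sum>f\<in>E G. w (\<pi> (fst f)) * \<phi> (fst f)) = 0"
    and phi_snd: "(\<Sum>f\<in>E G. w (\<pi> (fst f)) * \<phi> (snd f)) = 0"
begin

lemma base_arc_end: "f \<in> E G \<Longrightarrow> p \<in> {fst, snd} \<Longrightarrow> p f \<in> V G"
  using base_arc_ends[of f] by auto

lemma card_pos: "card (E G) > 0"
  using wf wf_graph_finite_arcs[OF wf] by (auto simp: wf_graph_def card_gt_0_iff)

text \<open>The third bound on \<open>f\<close> says that its L1 norm is at least half that of
  \<open>\<phi>\<close>. With edges of length \<open>1 / k ^ n\<close>, the functions counted for
  \<open>m\<close> have Lipschitz constant at most \<open>k ^ m\<close>.\<close>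

definition spectral_family :: "nat \<Rightarrow> 'a st_digraph \<Rightarrow> ('a \<Rightarrow> real) list \<Rightarrow> bool" where
  "spectral_family n H fs \<longleftrightarrow>
     (\<forall>f\<in>set fs. (\<forall>x\<in>V H. \<bar>f x\<bar> \<le> 1) \<and> (\<forall>e\<in>E H. f (fst e) * f (snd e) \<ge> 0) \<and>
        edge_abs_sum G \<phi> * card (E H) \<le> 2 * card (E G) * edge_abs_sum H f) \<and>
     sorted_wrt (edge_orthogonal H) fs \<and>
     (\<forall>m\<le>n. card (E G) ^ m \<le> 2 * card (E G) *
        length (filter (\<lambda>f. \<forall>e\<in>E H. \<bar>f (fst e) - f (snd e)\<bar> \<le> real k ^ m / real k ^ n) fs))"

text \<open>Choose \<open>w\<close> constant, the identity, or the shift by \<open>1 / k\<close>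
  that turns the level of the tail into that of the head. Thus \<open>\<phi>\<close> at either end
  is orthogonal to all affine functions of \<open>\<pi>\<close> at either end.\<close>

lemma phi_mean_weighted:
  assumes "p \<in> {fst, snd}" "r \<in> {fst, snd}"
  shows "(\<Sum>f\<in>E G. \<phi> (p f)) = 0" "(\<Sum>f\<in>E G. \<pi> (r f) * \<phi> (p f)) = 0"
proof -
  have *: "(\<Sum>f\<in>E G. w (\<pi> (fst f)) * \<phi> (p f)) = 0" for w
    using assms(1) phi_fst phi_snd by auto
  show "(\<Sum>f\<in>E G. \<phi> (p f)) = 0" using *[of "\<lambda>_. 1"] by simp
  have "(\<Sum>f\<in>E G. (\<pi> (fst f) + 1 / k) * \<phi> (p f)) = (\<Sum>f\<in>E G. \<pi> (snd f) * \<phi> (p f))"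
    by (intro sum.cong refl) (simp add: pi_step)
  then show "(\<Sum>f\<in>E G. \<pi> (r f) * \<phi> (p f)) = 0"
    using assms(2) *[of "\<lambda>x. x"] *[of "\<lambda>x. x + 1 / k"] by auto
qed

lemma sum_phi_abs_le: "edge_abs_sum G \<phi> \<le> 2 * card (E G)"
proof -
  have "edge_abs_sum G \<phi> \<le> (\<Sum>f\<in>E G. 2)"
    unfolding edge_abs_sum_def
  proof (rule sum_mono)
    fix f assume "f \<in> E G"
    then show "\<bar>\<phi> (fst f)\<bar> + \<bar>\<phi> (snd f)\<bar> \<le> 2"
      using phi_le[of "fst f"] phi_le[of "snd f"] wf_graph_arcD[OF wf] by fastforce
  qed
  then show ?thesis by simp
qed

lemma spectral_family_base: "spectral_family 1 G [\<lambda>x. 1, \<phi>]"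
proof -
  have N: "card (E G) \<ge> 1" using card_pos by simp
  have amp: "edge_abs_sum G \<phi> \<ge> 0" unfolding edge_abs_sum_def by (intro sum_nonneg) auto
  have "edge_abs_sum G \<phi> * card (E G) \<le> 2 * card (E G) * (2 * card (E G))"
    using mult_mono[OF sum_phi_abs_le order_refl[of "real (card (E G))"]] N
    by (auto intro: order_trans[rotated])
  moreover have "edge_abs_sum G (\<lambda>x. 1) = 2 * card (E G)" by (simp add: edge_abs_sum_def)
  moreover have "edge_abs_sum G \<phi> * card (E G) \<le> 2 * card (E G) * edge_abs_sum G \<phi>"
    using amp by (simp add: mult_right_mono)
  moreover have "edge_orthogonal G (\<lambda>x. 1) \<phi>"
    using phi_mean_weighted(1) by (auto simp: edge_orthogonal_def)
  \<comment> \<open>The constant function alone suffices for \<open>m \<le> 1\<close>.\<close>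
  moreover have "card (E G) ^ m \<le> 2 * card (E G) *
     length (filter (\<lambda>f. \<forall>e\<in>E G. \<bar>f (fst e) - f (snd e)\<bar> \<le> real k ^ m / real k ^ 1) [\<lambda>x. 1, \<phi>])"
    (is "_ \<le> 2 * card (E G) * length ?fs") if "m \<le> 1" for m
  proof -
    have "length ?fs \<ge> 1" by simp
    then have "2 * card (E G) * 1 \<le> 2 * card (E G) * length ?fs" by (intro mult_left_mono) auto
    moreover have "card (E G) ^ m \<le> card (E G) ^ 1" using that N by (intro power_increasing)
    ultimately show ?thesis by simp
  qed
  ultimately show ?thesis
    using phi_le phi_sign unfolding spectral_family_def by auto
qed

lemma spectral_family_rename:
  assumes "spectral_family n H fs" "wf_graph H" "\<And>x. x \<in> V H \<Longrightarrow> g (h x) = x"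
  shows "spectral_family n (rename_graph h H) (map (\<lambda>f x. f (g x)) fs)"
proof -
  have arcs: "fst e \<in> V H" "snd e \<in> V H" if "e \<in> E H" for e using wf_graph_arcD[OF assms(2) that] by auto
  have inj: "inj_on (map_prod h h) (E H)"
  proof (rule inj_onI)
    fix e e' assume "e \<in> E H" "e' \<in> E H" "map_prod h h e = map_prod h h e'"
    then show "e = e'" using arcs assms(3) by (metis prod.collapse fst_map_prod snd_map_prod)
  qed
  have sum: "(\<Sum>a\<in>map_prod h h ` E H. F a) = (\<Sum>e\<in>E H. F (h (fst e), h (snd e)))" for F :: "_ \<Rightarrow> real"
    by (subst sum.reindex[OF inj]) (simp add: o_def map_prod_def case_prod_unfold)
  have E: "E (rename_graph h H) = map_prod h h ` E H" and V: "V (rename_graph h H) = h ` V H"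
    by (auto simp: rename_graph_def)
  have orth: "edge_orthogonal (rename_graph h H) (\<lambda>x. f (g x)) (\<lambda>x. f' (g x)) \<longleftrightarrow> edge_orthogonal H f f'" for f f'
    using arcs assms(3) unfolding edge_orthogonal_def E by (simp add: sum)
  have abs: "edge_abs_sum (rename_graph h H) (\<lambda>x. f (g x)) = edge_abs_sum H f" for f
    using arcs assms(3) unfolding edge_abs_sum_def E by (simp add: sum)
  have card: "card (E (rename_graph h H)) = card (E H)" unfolding E by (rule card_image[OF inj])
  have filter: "length (filter (\<lambda>f. \<forall>e\<in>E (rename_graph h H). \<bar>f (fst e) - f (snd e)\<bar> \<le> c)
      (map (\<lambda>f x. f (g x)) fs))
    = length (filter (\<lambda>f. \<forall>e\<in>E H. \<bar>f (fst e) - f (snd e)\<bar> \<le> c) fs)" for c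
    using arcs assms(3) by (simp add: E filter_map o_def)
  show ?thesis
    using assms(1) arcs assms(3)
    unfolding spectral_family_def card sorted_wrt_map orth filter
    by (simp add: abs E V)
qed

section \<open>Interpolated functions and bumps on a glued product\<close>

context
  fixes H :: "'a st_digraph" and q :: "'a \<times> 'a \<Rightarrow> 'b \<Rightarrow> 'c" and K :: "'c st_digraph"
  assumes wfH: "wf_graph H" and glue: "glue_product H q K"
begin

definition interpolate :: "('a \<Rightarrow> real) \<Rightarrow> 'c \<Rightarrow> real" where
  "interpolate f = glue_fun H q (\<lambda>e u. (1 - \<pi> u) * f (fst e) + \<pi> u * f (snd e))"

definition bump :: "('a \<times> 'a \<Rightarrow> real) \<Rightarrow> 'c \<Rightarrow> real" where
  "bump h = glue_fun H q (\<lambda>e u. h e * \<phi> u)"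

text \<open>Well defined on classes: \<open>\<pi>\<close> is 0 at the source and 1 at the sink, so
  at a glued vertex the value is that of \<open>f\<close> there.\<close>

lemma interpolate_apply:
  assumes "e \<in> E H" "u \<in> V G"
  shows "interpolate f (q e u) = (1 - \<pi> u) * f (fst e) + \<pi> u * f (snd e)"
  unfolding interpolate_def
  by (subst glue_fun_apply[OF wfH glue _ assms])
     (auto simp: pi_source pi_sink oslash_endpoint_def source_neq_sink split: if_splits)

text \<open>Well defined on classes because \<open>\<phi>\<close> vanishes at both
  terminals.\<close>

lemma bump_apply:
  assumes "e \<in> E H" "u \<in> V G"
  shows "bump h (q e u) = h e * \<phi> u"
  unfolding bump_def
  by (subst glue_fun_apply[OF wfH glue _ assms]) (simp_all add: phi_ends)

lemma ball_V_glue: "(\<forall>x\<in>V K. P x) \<longleftrightarrow> (\<forall>e\<in>E H. \<forall>u\<in>V G. P (q e u))"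
  unfolding glue_productD(1)[OF glue] by auto

lemma ball_E_glue: "(\<forall>a\<in>E K. P a) \<longleftrightarrow> (\<forall>e\<in>E H. \<forall>f\<in>E G. P (q e (fst f), q e (snd f)))"
  unfolding glue_productD(2)[OF glue] by (auto simp: glue_edge_def)

lemma edge_orthogonal_glueI:
  assumes "\<And>p r. \<lbrakk>p \<in> {fst, snd}; r \<in> {fst, snd}\<rbrakk> \<Longrightarrow>
    (\<Sum>e\<in>E H. \<Sum>f\<in>E G. g (q e (p f)) * g' (q e (r f))) = 0"
  shows "edge_orthogonal K g g'"
  using assms[of fst fst] assms[of fst snd] assms[of snd fst] assms[of snd snd]
  unfolding edge_orthogonal_def sum_glue[OF wfH glue] by simp

text \<open>For a fixed edge of \<open>G\<close>, the product of two interpolants is a combination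
  of the four end-to-end products on \<open>H\<close>, with coefficients independent of the edge of
  \<open>H\<close>. Hence the sums are swapped first.\<close>

lemma edge_orthogonal_interpolate:
  assumes "edge_orthogonal H g g'"
  shows "edge_orthogonal K (interpolate g) (interpolate g')"
proof (rule edge_orthogonal_glueI)
  fix p r :: "'b \<times> 'b \<Rightarrow> 'b" assume pr: "p \<in> {fst, snd}" "r \<in> {fst, snd}"
  have z: "(\<Sum>e\<in>E H. g (fst e) * g' (fst e)) = 0" "(\<Sum>e\<in>E H. g (fst e) * g' (snd e)) = 0"
    "(\<Sum>e\<in>E H. g (snd e) * g' (fst e)) = 0" "(\<Sum>e\<in>E H. g (snd e) * g' (snd e)) = 0"
    using assms unfolding edge_orthogonal_def by auto
  have "(\<Sum>e\<in>E H. \<Sum>f\<in>E G. interpolate g (q e (p f)) * interpolate g' (q e (r f))) =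
    (\<Sum>f\<in>E G. \<Sum>e\<in>E H. interpolate g (q e (p f)) * interpolate g' (q e (r f)))"
    by (rule sum.swap)
  also have "\<dots> = (\<Sum>f\<in>E G. 0)"
  proof (rule sum.cong[OF refl])
    fix f assume f: "f \<in> E G"
    define a b where "a = \<pi> (p f)" and "b = \<pi> (r f)"
    have "(\<Sum>e\<in>E H. interpolate g (q e (p f)) * interpolate g' (q e (r f))) =
      (\<Sum>e\<in>E H. (1 - a) * (1 - b) * (g (fst e) * g' (fst e)) + (1 - a) * b * (g (fst e) * g' (snd e)) +
         (a * (1 - b) * (g (snd e) * g' (fst e)) + a * b * (g (snd e) * g' (snd e))))"
      by (intro sum.cong refl)
         (simp add: interpolate_apply base_arc_end[OF f pr(1)] base_arc_end[OF f pr(2)] a_def b_def algebra_simps)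
    also have "\<dots> = 0"
      unfolding sum.distrib sum_distrib_left[symmetric] z by simp
    finally show "(\<Sum>e\<in>E H. interpolate g (q e (p f)) * interpolate g' (q e (r f))) = 0" .
  qed
  finally show "(\<Sum>e\<in>E H. \<Sum>f\<in>E G. interpolate g (q e (p f)) * interpolate g' (q e (r f))) = 0" by simp
qed

text \<open>The sum vanishes on each copy separately, since an interpolant is affine in
  \<open>\<pi>\<close> there.\<close>

lemma edge_orthogonal_interpolate_bump: "edge_orthogonal K (interpolate g) (bump h)"
proof (rule edge_orthogonal_glueI)
  fix p r :: "'b \<times> 'b \<Rightarrow> 'b" assume pr: "p \<in> {fst, snd}" "r \<in> {fst, snd}"
  have "(\<Sum>f\<in>E G. interpolate g (q e (p f)) * bump h (q e (r f))) = 0" if e: "e \<in> E H" for e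
  proof -
    have "(\<Sum>f\<in>E G. interpolate g (q e (p f)) * bump h (q e (r f))) =
      (\<Sum>f\<in>E G. h e * g (fst e) * \<phi> (r f) + h e * (g (snd e) - g (fst e)) * (\<pi> (p f) * \<phi> (r f)))"
      by (intro sum.cong refl)
         (simp add: interpolate_apply[OF e] bump_apply[OF e] base_arc_end[OF _ pr(1)]
            base_arc_end[OF _ pr(2)] algebra_simps)
    also have "\<dots> = 0"
      unfolding sum.distrib sum_distrib_left[symmetric] phi_mean_weighted(1)[OF pr(2,1)]
        phi_mean_weighted(2)[OF pr(2,1)] by simp
    finally show ?thesis .
  qed
  then show "(\<Sum>e\<in>E H. \<Sum>f\<in>E G. interpolate g (q e (p f)) * bump h (q e (r f))) = 0" by simp
qed

lemma edge_orthogonal_bump: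
  assumes "(\<Sum>e\<in>E H. h e * h' e) = 0"
  shows "edge_orthogonal K (bump h) (bump h')"
proof (rule edge_orthogonal_glueI)
  fix p r :: "'b \<times> 'b \<Rightarrow> 'b" assume pr: "p \<in> {fst, snd}" "r \<in> {fst, snd}"
  have "(\<Sum>e\<in>E H. \<Sum>f\<in>E G. bump h (q e (p f)) * bump h' (q e (r f))) =
    (\<Sum>e\<in>E H. \<Sum>f\<in>E G. (h e * h' e) * (\<phi> (p f) * \<phi> (r f)))"
    by (intro sum.cong refl) (simp add: bump_apply base_arc_end[OF _ pr(1)] base_arc_end[OF _ pr(2)])
  also have "\<dots> = (\<Sum>e\<in>E H. h e * h' e) * (\<Sum>f\<in>E G. \<phi> (p f) * \<phi> (r f))"
    by (rule sum_product[symmetric])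
  finally show "(\<Sum>e\<in>E H. \<Sum>f\<in>E G. bump h (q e (p f)) * bump h' (q e (r f))) = 0"
    using assms by simp
qed

text \<open>Equal signs let the absolute value pass through the interpolation, and
  \<open>pi_mean\<close> gives both ends of an edge of \<open>H\<close> the same total
  weight.\<close>

lemma edge_abs_sum_interpolate:
  assumes "\<forall>e\<in>E H. g (fst e) * g (snd e) \<ge> 0"
  shows "edge_abs_sum K (interpolate g) = card (E G) * edge_abs_sum H g"
proof -
  have "(\<Sum>f\<in>E G. \<bar>interpolate g (q e (fst f))\<bar> + \<bar>interpolate g (q e (snd f))\<bar>) =
    card (E G) * (\<bar>g (fst e)\<bar> + \<bar>g (snd e)\<bar>)" if e: "e \<in> E H" for e
  proof -
    have "(\<Sum>f\<in>E G. \<bar>interpolate g (q e (fst f))\<bar> + \<bar>interpolate g (q e (snd f))\<bar>) =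
      (\<Sum>f\<in>E G. 2 * \<bar>g (fst e)\<bar> + (\<bar>g (snd e)\<bar> - \<bar>g (fst e)\<bar>) * (\<pi> (fst f) + \<pi> (snd f)))"
      using assms e pi_range base_arc_ends
      by (intro sum.cong refl, simp add: interpolate_apply[OF e] abs_interpolation,
          simp add: algebra_simps)
    also have "\<dots> = card (E G) * (\<bar>g (fst e)\<bar> + \<bar>g (snd e)\<bar>)"
      unfolding sum.distrib[of "\<lambda>f. 2 * \<bar>g (fst e)\<bar>"] sum_distrib_left[symmetric] pi_mean
      by (simp add: algebra_simps)
    finally show ?thesis .
  qed
  then show ?thesis
    unfolding edge_abs_sum_def sum_glue[OF wfH glue] by (simp add: sum_distrib_left)
qed

lemma edge_abs_sum_bump: "edge_abs_sum K (bump h) = (\<Sum>e\<in>E H. \<bar>h e\<bar>) * edge_abs_sum G \<phi>"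
proof -
  have "edge_abs_sum K (bump h) = (\<Sum>e\<in>E H. \<Sum>f\<in>E G. \<bar>h e\<bar> * (\<bar>\<phi> (fst f)\<bar> + \<bar>\<phi> (snd f)\<bar>))"
    unfolding edge_abs_sum_def sum_glue[OF wfH glue]
    by (intro sum.cong refl) (simp add: bump_apply base_arc_ends abs_mult algebra_simps)
  then show ?thesis unfolding edge_abs_sum_def sum_product .
qed

text \<open>The interpolants supply the count for \<open>m \<le> n\<close>, the bumps the one for
  \<open>m = Suc n\<close>, where half of \<open>card (E H)\<close> functions are enough.\<close>

lemma spectral_family_glue:
  assumes fs: "spectral_family n H fs" and card_H: "card (E H) = card (E G) ^ n"
  shows "\<exists>fs'. spectral_family (Suc n) K fs'"
proof -
  note fsD = fs[unfolded spectral_family_def]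
  obtain hs :: "('a \<times> 'a \<Rightarrow> real) list" where len: "card (E H) \<le> 2 * length hs"
    and h_le: "\<And>h e. h \<in> set hs \<Longrightarrow> \<bar>h e\<bar> \<le> 1"
    and h_sum: "\<And>h. h \<in> set hs \<Longrightarrow> real (card (E H)) \<le> 2 * (\<Sum>e\<in>E H. \<bar>h e\<bar>)"
    and orth: "sorted_wrt (\<lambda>h h'. (\<Sum>e\<in>E H. h e * h' e) = 0) hs"
  proof -
    have "finite (E H)" "E H \<noteq> {}"
      using wfH wf_graph_finite_arcs[OF wfH] by (auto simp: wf_graph_def)
    from walsh_functions[OF this] show thesis using that by blast
  qed
  define fs' where "fs' = map interpolate fs @ map bump hs"
  have k0: "real k > 0" using k by simp
  have amp: "edge_abs_sum G \<phi> \<ge> 0" unfolding edge_abs_sum_def by (intro sum_nonneg) auto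
  have lift_le: "\<bar>interpolate f x\<bar> \<le> 1" if f: "f \<in> set fs" and x: "x \<in> V K" for f x
  proof -
    from x obtain e u where eu: "e \<in> E H" "u \<in> V G" "x = q e u"
      unfolding glue_productD(1)[OF glue] by auto
    have "\<bar>f (fst e)\<bar> \<le> 1" "\<bar>f (snd e)\<bar> \<le> 1" using fsD f wf_graph_arcD[OF wfH eu(1)] by auto
    then have "(1 - \<pi> u) * \<bar>f (fst e)\<bar> + \<pi> u * \<bar>f (snd e)\<bar> \<le> (1 - \<pi> u) * 1 + \<pi> u * 1"
      using pi_range[OF eu(2)] by (intro add_mono mult_left_mono) auto
    moreover have "f (fst e) * f (snd e) \<ge> 0" using fsD f eu(1) by auto
    ultimately show ?thesis
      unfolding eu(3) interpolate_apply[OF eu(1,2)] using pi_range[OF eu(2)]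
      by (simp add: abs_interpolation)
  qed
  have bump_le: "\<bar>h e * \<phi> u\<bar> \<le> 1" if "h \<in> set hs" "u \<in> V G" for h e u
    using mult_mono[OF h_le[OF that(1)] phi_le[OF that(2)]] by (simp add: abs_mult)
  have bump_sign: "(h e * \<phi> (fst f)) * (h e * \<phi> (snd f)) \<ge> 0" if "f \<in> E G" for h :: "'a \<times> 'a \<Rightarrow> real" and e f
    using mult_nonneg_nonneg[OF zero_le_power2[of "h e"] phi_sign[OF that]]
    by (simp add: power2_eq_square mult_ac)
  have props: "(\<forall>x\<in>V K. \<bar>f x\<bar> \<le> 1) \<and> (\<forall>e\<in>E K. f (fst e) * f (snd e) \<ge> 0) \<and>
        edge_abs_sum G \<phi> * card (E K) \<le> 2 * card (E G) * edge_abs_sum K f" if "f \<in> set fs'" for f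
  proof -
    from that consider g where "g \<in> set fs" "f = interpolate g" | h where "h \<in> set hs" "f = bump h"
      unfolding fs'_def by auto
    then show ?thesis
    proof cases
      case 1
      have sg: "\<forall>e\<in>E H. g (fst e) * g (snd e) \<ge> 0" using fsD 1 by auto
      have "edge_abs_sum G \<phi> * card (E H) \<le> 2 * card (E G) * edge_abs_sum H g" using fsD 1 by auto
      \<comment> \<open>Passing from \<open>H\<close> to \<open>K\<close> multiplies both the number
        of edges and \<open>edge_abs_sum\<close> by \<open>card (E G)\<close>.\<close>
      from mult_right_mono[OF this, of "card (E G)"]
      have "edge_abs_sum G \<phi> * card (E K) \<le> 2 * card (E G) * edge_abs_sum K f"
        unfolding 1(2) edge_abs_sum_interpolate[OF sg] card_glue[OF wfH glue] by (simp add: mult_ac)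
      moreover have "f (fst e) * f (snd e) \<ge> 0" if "e \<in> E K" for e
      proof -
        from that obtain a f where "a \<in> E H" "f \<in> E G" "e = (q a (fst f), q a (snd f))"
          unfolding glue_productD(2)[OF glue] by (auto simp: glue_edge_def)
        then show ?thesis
          using sg pi_range base_arc_ends[of f] unfolding 1(2)
          by (simp add: interpolate_apply interpolation_same_sign)
      qed
      ultimately show ?thesis using lift_le 1 by auto
    next
      case 2
      \<comment> \<open>The factor 2 on the right absorbs the edges on which the Walsh function
        vanishes.\<close>
      have "edge_abs_sum G \<phi> * card (E K) \<le> 2 * card (E G) * edge_abs_sum K f"
        unfolding 2(2) edge_abs_sum_bump card_glue[OF wfH glue]
        using mult_left_mono[OF h_sum[OF 2(1)], of "edge_abs_sum G \<phi> * card (E G)"] amp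
        by (simp add: mult_ac)
      moreover have "f (fst e) * f (snd e) \<ge> 0" if "e \<in> E K" for e
        using that base_arc_ends bump_sign unfolding 2(2) glue_productD(2)[OF glue]
        by (auto simp: glue_edge_def bump_apply)
      ultimately show ?thesis
        using 2 bump_le by (auto simp: ball_V_glue bump_apply)
    qed
  qed
  have sorted: "sorted_wrt (edge_orthogonal K) fs'"
    unfolding fs'_def sorted_wrt_append sorted_wrt_map
    using fsD orth edge_orthogonal_interpolate_bump
    by (auto intro: sorted_wrt_mono_rel[rotated] edge_orthogonal_interpolate edge_orthogonal_bump)
  have count: "card (E G) ^ m \<le> 2 * card (E G) *
      length (filter (\<lambda>f. \<forall>e\<in>E K. \<bar>f (fst e) - f (snd e)\<bar> \<le> real k ^ m / real k ^ Suc n) fs')"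
    (is "_ \<le> 2 * card (E G) * length (filter (?P m) fs')") if m: "m \<le> Suc n" for m
  proof (cases "m = Suc n")
    case True
    \<comment> \<open>For \<open>m = Suc n\<close> the threshold is 1. A bump is bounded by 1 and
      does not change sign along an edge, so its increments are at most 1 and not 2.\<close>
    have "?P m (bump h)" if "h \<in> set hs" for h
      using base_arc_ends bump_le[OF that] bump_sign True k0
      by (auto simp: ball_E_glue bump_apply intro!: same_sign_diff_le)
    then have "filter (?P m) (map bump hs) = map bump hs"
      by (intro filter_True) auto
    then have "length (filter (?P m) fs') \<ge> length hs" by (simp add: fs'_def)
    then have "2 * length (filter (?P m) fs') \<ge> card (E G) ^ n" using len card_H by simp
    from mult_left_mono[OF this, of "card (E G)"] show ?thesis
      using True by (simp add: mult_ac)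
  next
    case False
    define Q where "Q = (\<lambda>f. \<forall>e\<in>E H. \<bar>f (fst e) - f (snd e)\<bar> \<le> real k ^ m / real k ^ n)"
    have PQ: "?P m (interpolate f)" if "Q f" for f
      unfolding ball_E_glue
    proof (intro ballI)
      fix e g assume e: "e \<in> E H" and g: "g \<in> E G"
      \<comment> \<open>Along a copy \<open>\<pi>\<close> moves in steps of \<open>1 / k\<close>,
        which matches the change of the denominator from \<open>k ^ n\<close> to
        \<open>k ^ Suc n\<close>.\<close>
      have "interpolate f (q e (fst g)) - interpolate f (q e (snd g)) = (1 / k) * (f (fst e) - f (snd e))"
        using base_arc_ends[OF g] by (simp add: interpolate_apply[OF e] pi_step[OF g] algebra_simps)
      then have "\<bar>interpolate f (q e (fst g)) - interpolate f (q e (snd g))\<bar> = (1 / k) * \<bar>f (fst e) - f (snd e)\<bar>"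
        using k0 by (simp add: abs_mult)
      also have "\<dots> \<le> (1 / k) * (real k ^ m / real k ^ n)"
        using that e k0 unfolding Q_def by (intro mult_left_mono) auto
      also have "\<dots> = real k ^ m / real k ^ Suc n" by simp
      finally show "\<bar>interpolate f (fst (q e (fst g), q e (snd g))) -
        interpolate f (snd (q e (fst g), q e (snd g)))\<bar> \<le> real k ^ m / real k ^ Suc n" by simp
    qed
    have "length (filter Q fs) \<le> length (filter (?P m \<circ> interpolate) fs)"
      using PQ by (induction fs) auto
    also have "\<dots> = length (filter (?P m) (map interpolate fs))" by (simp add: filter_map)
    also have "\<dots> \<le> length (filter (?P m) fs')" by (simp add: fs'_def)
    finally have "2 * card (E G) * length (filter Q fs) \<le> 2 * card (E G) * length (filter (?P m) fs')"
      by (intro mult_left_mono) auto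
    moreover have "card (E G) ^ m \<le> 2 * card (E G) * length (filter Q fs)"
      using fsD False m unfolding Q_def by auto
    ultimately show ?thesis by linarith
  qed
  show ?thesis
    using props sorted count unfolding spectral_family_def by (intro exI[of _ fs']) blast
qed

end
end

section \<open>The vertex measure\<close>

text \<open>Double counting of incidences: each edge passes half of its mass to each of its two
  ends.\<close>

lemma sum_vertex_weight:
  fixes F :: "'a \<Rightarrow> real"
  assumes "wf_graph H"
  shows "(\<Sum>x\<in>V H. (1 / 2 * (\<Sum>e \<in> {e \<in> E H. x \<in> {fst e, snd e}}. pmf (pmf_of_set (E H)) e)) * F x) =
    (\<Sum>e\<in>E H. F (fst e) + F (snd e)) / (2 * card (E H))"
proof -
  have fin: "finite (E H)" "E H \<noteq> {}" "finite (V H)"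
    using assms wf_graph_finite_arcs[OF assms] by (auto simp: wf_graph_def)
  have "(\<Sum>x\<in>V H. (1 / 2 * (\<Sum>e \<in> {e \<in> E H. x \<in> {fst e, snd e}}. pmf (pmf_of_set (E H)) e)) * F x) =
    (\<Sum>x\<in>V H. \<Sum>e\<in>E H. if x \<in> {fst e, snd e} then F x / (2 * card (E H)) else 0)"
  proof (rule sum.cong[OF refl])
    fix x
    have "(\<Sum>e \<in> {e \<in> E H. x \<in> {fst e, snd e}}. pmf (pmf_of_set (E H)) e) =
      (\<Sum>e\<in>E H. if x \<in> {fst e, snd e} then pmf (pmf_of_set (E H)) e else 0)"
      using fin by (intro sum.inter_filter)
    also have "\<dots> = (\<Sum>e\<in>E H. if x \<in> {fst e, snd e} then 1 / card (E H) else 0)"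
      using fin by (intro sum.cong) auto
    finally show "(1 / 2 * (\<Sum>e \<in> {e \<in> E H. x \<in> {fst e, snd e}}. pmf (pmf_of_set (E H)) e)) * F x =
      (\<Sum>e\<in>E H. if x \<in> {fst e, snd e} then F x / (2 * card (E H)) else 0)"
      by (simp add: sum_distrib_left sum_distrib_right if_distrib if_distribR cong: if_cong)
  qed
  also have "\<dots> = (\<Sum>e\<in>E H. \<Sum>x\<in>V H. if x \<in> {fst e, snd e} then F x / (2 * card (E H)) else 0)"
    by (rule sum.swap)
  also have "\<dots> = (\<Sum>e\<in>E H. (F (fst e) + F (snd e)) / (2 * card (E H)))"
  proof (rule sum.cong[OF refl])
    fix e assume "e \<in> E H"
    from wf_graph_arcD[OF assms this] have e: "{fst e, snd e} \<subseteq> V H" "fst e \<noteq> snd e" by auto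
    have "(\<Sum>x\<in>V H. if x \<in> {fst e, snd e} then F x / (2 * card (E H)) else 0) =
      (\<Sum>x\<in>{x \<in> V H. x \<in> {fst e, snd e}}. F x / (2 * card (E H)))"
      using fin by (intro sum.inter_filter[symmetric])
    also have "{x \<in> V H. x \<in> {fst e, snd e}} = {fst e, snd e}" using e by auto
    also have "(\<Sum>x\<in>{fst e, snd e}. F x / (2 * card (E H))) = (F (fst e) + F (snd e)) / (2 * card (E H))"
      using e by (simp add: add_divide_distrib)
    finally show "(\<Sum>x\<in>V H. if x \<in> {fst e, snd e} then F x / (2 * card (E H)) else 0) =
      (F (fst e) + F (snd e)) / (2 * card (E H))" .
  qed
  finally show ?thesis by (simp add: sum_divide_distrib)
qed

lemma space_vertex_measure: "space (vertex_measure H \<nu>) = V H"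
  by (simp add: vertex_measure_def space_point_measure)

lemma borel_measurable_vertex_measure: "f \<in> borel_measurable (vertex_measure H \<nu>)"
  by (simp add: vertex_measure_def)

lemma nn_integral_vertex_measure:
  assumes "wf_graph H" "\<And>x. F x \<ge> 0"
  shows "(\<integral>\<^sup>+ x. ennreal (F x) \<partial>vertex_measure H (pmf_of_set (E H))) =
    ennreal ((\<Sum>e\<in>E H. F (fst e) + F (snd e)) / (2 * card (E H)))"
proof -
  have fin: "finite (V H)" using assms(1) by (simp add: wf_graph_def)
  show ?thesis
    unfolding sum_vertex_weight[OF assms(1), symmetric] vertex_measure_def
      nn_integral_point_measure_finite[OF fin]
    using assms(2) by (simp add: ennreal_mult[symmetric] sum_ennreal sum_nonneg)
qed

lemma integral_vertex_measure:
  fixes F :: "'a \<Rightarrow> real"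
  assumes "wf_graph H"
  shows "(\<integral>x. F x \<partial>vertex_measure H (pmf_of_set (E H))) =
    (\<Sum>e\<in>E H. F (fst e) + F (snd e)) / (2 * card (E H))"
proof -
  have fin: "finite (V H)" using assms(1) by (simp add: wf_graph_def)
  show ?thesis
    unfolding sum_vertex_weight[OF assms(1), symmetric] vertex_measure_def
    by (subst lebesgue_integral_point_measure_finite[OF fin]) (auto intro: sum_nonneg)
qed

lemma L1_norm_vertex_measure:
  assumes "wf_graph H"
  shows "L1_norm (vertex_measure H (pmf_of_set (E H))) f = ennreal (edge_abs_sum H f / (2 * card (E H)))"
  unfolding L1_norm_def edge_abs_sum_def by (rule nn_integral_vertex_measure[OF assms]) simp

lemma emeasure_space_vertex_measure:
  assumes "wf_graph H"
  shows "emeasure (vertex_measure H (pmf_of_set (E H))) (V H) = 1"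
proof -
  have card: "card (E H) > 0" using assms wf_graph_finite_arcs[OF assms] by (auto simp: wf_graph_def card_gt_0_iff)
  have "emeasure (vertex_measure H (pmf_of_set (E H))) (V H) =
      (\<integral>\<^sup>+ x. ennreal 1 \<partial>vertex_measure H (pmf_of_set (E H)))"
    by (simp add: space_vertex_measure)
  also have "\<dots> = ennreal ((\<Sum>e\<in>E H. 1 + 1) / (2 * card (E H)))"
    by (rule nn_integral_vertex_measure[OF assms]) simp
  also have "\<dots> = 1" using card by simp
  finally show ?thesis .
qed

lemma Linf_norm_vertex_measure_le:
  assumes "\<And>x. x \<in> V H \<Longrightarrow> \<bar>f x\<bar> \<le> c"
  shows "Linf_norm (vertex_measure H \<nu>) f \<le> ennreal c"
proof -
  have "AE x in vertex_measure H \<nu>. ennreal \<bar>f x\<bar> \<le> ennreal c"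
    unfolding vertex_measure_def AE_point_measure using assms by (simp add: ennreal_leI)
  then show ?thesis
    unfolding Linf_norm_def by (rule esssup_I[OF borel_measurable_vertex_measure])
qed

text \<open>Every vertex lies on an edge and so has positive mass; the essential supremum therefore
  sees every value.\<close>

lemma Linf_norm_vertex_measure_ge:
  assumes "wf_graph H" "x \<in> V H"
  shows "ennreal \<bar>f x\<bar> \<le> Linf_norm (vertex_measure H (pmf_of_set (E H))) f"
proof -
  have fin: "finite (E H)" "E H \<noteq> {}"
    using assms wf_graph_finite_arcs[OF assms(1)] by (auto simp: wf_graph_def)
  obtain e where e: "e \<in> E H" "x \<in> {fst e, snd e}" using wf_graph_incident[OF assms] by blast
  have "0 < (\<Sum>e \<in> {e \<in> E H. x \<in> {fst e, snd e}}. pmf (pmf_of_set (E H)) e)"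
    using e fin by (intro sum_pos2[of _ e]) (auto simp: card_gt_0_iff)
  moreover have "AE x in vertex_measure H (pmf_of_set (E H)).
      ennreal \<bar>f x\<bar> \<le> Linf_norm (vertex_measure H (pmf_of_set (E H))) f"
    unfolding Linf_norm_def by (rule esssup_AE)
  ultimately show ?thesis
    using assms(2) unfolding vertex_measure_def AE_point_measure by auto
qed

lemma L1_norm_le_Linf_norm:
  assumes "wf_graph H"
  shows "L1_norm (vertex_measure H (pmf_of_set (E H))) f \<le> Linf_norm (vertex_measure H (pmf_of_set (E H))) f"
    (is "L1_norm ?\<mu> f \<le> _")
proof -
  have "L1_norm ?\<mu> f \<le> (\<integral>\<^sup>+ x. Linf_norm ?\<mu> f \<partial>?\<mu>)"
    unfolding L1_norm_def Linf_norm_def by (intro nn_integral_mono_AE esssup_AE)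
  also have "\<dots> = Linf_norm ?\<mu> f"
    using emeasure_space_vertex_measure[OF assms] by (simp add: space_vertex_measure)
  finally show ?thesis .
qed

text \<open>The integral involves the two correlations with matching ends; the mixed ones serve the
  induction.\<close>

lemma integral_edge_orthogonal:
  assumes "wf_graph H" "edge_orthogonal H f g"
  shows "(\<integral>x. f x * g x \<partial>vertex_measure H (pmf_of_set (E H))) = 0"
  unfolding integral_vertex_measure[OF assms(1)] sum.distrib
  using assms(2) by (simp add: edge_orthogonal_def)

section \<open>Powers of the base graph\<close>

lemma between_powers:
  fixes s :: real and k :: nat
  assumes "1 \<le> s" "s \<le> real k ^ n" "k \<ge> 2"
  shows "\<exists>m\<le>n. real k ^ m \<le> s \<and> s \<le> real k ^ Suc m"
  using assms(2)
proof (induction n)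
  case 0
  then show ?case using assms by auto
next
  case (Suc n)
  then show ?case
  proof (cases "s \<le> real k ^ n")
    case True
    then show ?thesis using Suc.IH by (meson le_Suc_eq)
  next
    case False
    then show ?thesis using Suc.prems by (intro exI[of _ n]) auto
  qed
qed

text \<open>The dimension is the exponent that turns \<open>k\<close> into the number
  \<open>N\<close> of edges.\<close>

lemma power_powr_log:
  assumes "k \<ge> 2" "N > 0"
  shows "(real k ^ j) powr (ln (real N) / ln (real k)) = real N ^ j"
proof -
  have "ln (real k) > 0" using assms by simp
  then have "(real k ^ j) powr (ln (real N) / ln (real k)) = exp (j * ln (real N))"
    using assms(1) by (simp add: powr_def ln_realpow)
  also have "\<dots> = real N ^ j" using assms(2) by (simp add: exp_of_nat_mult)
  finally show ?thesis .
qed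

section \<open>Metrics, structure and profile of the powers\<close>

context collapsing_graph
begin

text \<open>The second conjunct stands in for geodesicity: it yields the Lipschitz estimates and
  passes through renaming without transporting vertex lists.\<close>

definition scaled_metric :: "nat \<Rightarrow> 'a st_digraph \<Rightarrow> ('a \<Rightarrow> 'a \<Rightarrow> real) \<Rightarrow> bool" where
  "scaled_metric n H d \<longleftrightarrow> (\<forall>e\<in>E H. edge_len d e = 1 / real k ^ n) \<and>
     (\<forall>x\<in>V H. \<forall>y\<in>V H. \<exists>m. (x, y) \<in> sym_arcs (E H) ^^ m \<and> d x y = real m * (1 / real k ^ n))"

lemma scaled_metric_geodesic:
  assumes "geodesic_metric (graph_of H) d" "\<forall>e\<in>E H. edge_len d e = 1 / real k ^ n"
  shows "scaled_metric n H d"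
  unfolding scaled_metric_def using geodesic_metric_relpow[OF assms] assms(2) by blast

lemma scaled_metric_rename:
  assumes "scaled_metric n H d" "wf_graph H" "inj_on h (V H)"
  shows "scaled_metric n (rename_graph h H) (rename_metric h H d)"
proof -
  have d: "rename_metric h H d (h x) (h y) = d x y" if "x \<in> V H" "y \<in> V H" for x y
    using that assms(3) by (simp add: rename_metric_def)
  have "edge_len (rename_metric h H d) a = 1 / real k ^ n" if "a \<in> E (rename_graph h H)" for a
  proof -
    from that obtain e where e: "e \<in> E H" "a = map_prod h h e" by (auto simp: rename_graph_def)
    then show ?thesis
      using d wf_graph_arcD[OF assms(2) e(1)] assms(1) by (simp add: scaled_metric_def)
  qed
  moreover have "\<exists>m. (a, b) \<in> sym_arcs (E (rename_graph h H)) ^^ m \<and>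
      rename_metric h H d a b = real m * (1 / real k ^ n)"
    if "a \<in> V (rename_graph h H)" "b \<in> V (rename_graph h H)" for a b
  proof -
    from that obtain x y where xy: "x \<in> V H" "y \<in> V H" "a = h x" "b = h y"
      by (auto simp: rename_graph_def)
    then obtain m where m: "(x, y) \<in> sym_arcs (E H) ^^ m" "d x y = real m * (1 / real k ^ n)"
      using assms(1) unfolding scaled_metric_def by blast
    have "(h x, h y) \<in> sym_arcs (E (rename_graph h H)) ^^ m"
      by (rule relpow_image[OF m(1)]) (auto simp: rename_graph_def intro: rev_image_eqI)
    then show ?thesis using xy m(2) d by auto
  qed
  ultimately show ?thesis unfolding scaled_metric_def by blast
qed

text \<open>With constant edge lengths in both factors, the prescription in
  \<open>oslash_metric\<close> says that all edges of the product have length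
  \<open>1 / k ^ Suc n\<close>, so \<open>ex1_path_metric\<close> identifies the
  \<open>THE\<close>.\<close>

lemma scaled_metric_oslash:
  assumes H: "wf_graph H" and dH: "scaled_metric n H dH" and dG: "scaled_metric 1 G dG"
  shows "scaled_metric (Suc n) (oslash H G) (oslash_metric H G dH dG)"
proof -
  let ?K = "oslash H G"
  let ?c = "1 / real k ^ Suc n"
  have wfK: "wf_graph ?K" by (rule wf_graph_glue[OF H glue_product_oslash])
  have "(\<forall>e\<in>E H. \<forall>f\<in>E G. edge_len d (oslash_edge H G e f) = edge_len dH e * edge_len dG f)
    \<longleftrightarrow> (\<forall>a\<in>E ?K. edge_len d a = ?c)" for d
  proof -
    have "edge_len dH e * edge_len dG f = ?c" if "e \<in> E H" "f \<in> E G" for e f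
      using that dH dG by (simp add: scaled_metric_def)
    moreover have "(\<forall>a\<in>E ?K. edge_len d a = ?c) \<longleftrightarrow>
        (\<forall>e\<in>E H. \<forall>f\<in>E G. edge_len d (oslash_edge H G e f) = ?c)"
    proof -
      have ball: "(\<forall>a \<in> {X e f | e f. e \<in> A \<and> f \<in> B}. R a) \<longleftrightarrow> (\<forall>e\<in>A. \<forall>f\<in>B. R (X e f))"
        for X :: "'a \<times> 'a \<Rightarrow> 'b \<times> 'b \<Rightarrow> 'z" and A B R by blast
      have "E ?K = {oslash_edge H G e f | e f. e \<in> E H \<and> f \<in> E G}" by (simp add: oslash_def)
      then show ?thesis by (simp only: ball)
    qed
    ultimately show ?thesis by simp
  qed
  then have eq: "oslash_metric H G dH dG = (THE d. geodesic_metric (graph_of ?K) d \<and>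
      (\<forall>a\<in>E ?K. edge_len d a = ?c) \<and> (\<forall>x y. x \<notin> V ?K \<or> y \<notin> V ?K \<longrightarrow> d x y = 0))"
    unfolding oslash_metric_def by simp
  have ex1: "\<exists>!d. geodesic_metric (graph_of ?K) d \<and>
      (\<forall>a\<in>E ?K. edge_len d a = ?c) \<and> (\<forall>x y. x \<notin> V ?K \<or> y \<notin> V ?K \<longrightarrow> d x y = 0)"
    using wfK k unfolding wf_graph_def by (intro ex1_path_metric) auto
  from theI'[OF ex1] have "geodesic_metric (graph_of ?K) (oslash_metric H G dH dG)"
    "\<forall>a\<in>E ?K. edge_len (oslash_metric H G dH dG) a = ?c"
    unfolding eq[symmetric] by blast+
  then show ?thesis by (rule scaled_metric_geodesic)
qed

text \<open>\<open>Abs_fset\<close> is faithful on finite sets, and each class is a subset of the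
  finite set \<open>E H \<times> V G\<close>.\<close>

lemma inj_on_cls:
  assumes "wf_graph H"
  shows "inj_on cls (V (oslash H G))"
proof (rule inj_onI)
  have fin: "finite X" if "X \<in> V (oslash H G)" for X
  proof -
    have "X \<subseteq> E H \<times> V G"
      using that in_quotient_imp_subset[OF equiv_oslash_rel] by (simp add: oslash_def)
    then show ?thesis
      using wf_graph_finite_arcs[OF assms] wf unfolding wf_graph_def
      by (meson finite_SigmaI finite_subset)
  qed
  fix X Y assume "X \<in> V (oslash H G)" "Y \<in> V (oslash H G)" "cls X = cls Y"
  then show "X = Y" using fin by (simp add: cls_def Abs_fset_inject)
qed

lemma oslash_power_structure:
  assumes dG: "scaled_metric 1 G d" and n: "n \<ge> 1"
  shows "wf_graph (oslash_power G n) \<and> card (E (oslash_power G n)) = card (E G) ^ n \<and>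
    oslash_power_measure G (pmf_of_set (E G)) n = pmf_of_set (E (oslash_power G n)) \<and>
    scaled_metric n (oslash_power G n) (oslash_power_metric G d n) \<and>
    (\<exists>fs. spectral_family n (oslash_power G n) fs)"
  using n
proof (induction n rule: nat_induct_at_least)
  case base
  have inj: "inj_on Base (V G)" by (auto intro: inj_onI)
  have injE: "inj_on (map_prod Base Base) (E G)" by (auto intro: inj_onI)
  have E: "E (rename_graph Base G) = map_prod Base Base ` E G" by (simp add: rename_graph_def)
  have fin: "finite (E G)" "E G \<noteq> {}" using wf wf_graph_finite_arcs[OF wf] by (auto simp: wf_graph_def)
  \<comment> \<open>The \<open>case\<close> function undoes \<open>Base\<close>; its unspecified
    values on \<open>Cls\<close> lie off the vertex set.\<close>
  have "\<exists>fs. spectral_family 1 (rename_graph Base G) fs"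
    using spectral_family_rename[OF spectral_family_base wf, of "\<lambda>x. case x of Base a \<Rightarrow> a" Base]
    by (auto intro!: exI)
  then show ?case
    using wf_graph_rename[OF wf inj] scaled_metric_rename[OF dG wf inj] fin
    by (simp add: E card_image[OF injE] map_pmf_of_set_inj[OF injE])
next
  case (Suc n)
  let ?H = "oslash_power G n"
  let ?K = "rename_graph cls (oslash ?H G)"
  let ?q = "\<lambda>e u. cls (oslash_vertex ?H G e u)"
  from Suc have H: "wf_graph ?H" and cH: "card (E ?H) = card (E G) ^ n"
    and nH: "oslash_power_measure G (pmf_of_set (E G)) n = pmf_of_set (E ?H)"
    and dH: "scaled_metric n ?H (oslash_power_metric G d n)"
    and fH: "\<exists>fs. spectral_family n ?H fs" by auto
  \<comment> \<open>Exponents start at 1, so the recursive equations apply to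
    \<open>Suc (Suc n')\<close>.\<close>
  obtain n' where n': "n = Suc n'" using Suc.hyps by (cases n) auto
  have glue: "glue_product ?H ?q ?K"
    by (rule glue_product_rename[OF glue_product_oslash inj_on_cls[OF H]])
  have wfO: "wf_graph (oslash ?H G)" by (rule wf_graph_glue[OF H glue_product_oslash])
  have "map_prod cls cls (oslash_edge ?H G e f) = glue_edge ?q (e, f)" for e f
    by (simp add: oslash_edge_def glue_edge_def)
  then have "oslash_power_measure G (pmf_of_set (E G)) (Suc n) =
      map_pmf (glue_edge ?q) (pair_pmf (pmf_of_set (E ?H)) (pmf_of_set (E G)))"
    by (simp add: n' oslash_measure_def nH[unfolded n'] map_pmf_comp case_prod_unfold)
  also have "\<dots> = pmf_of_set (E ?K)" by (rule pmf_glue[OF H glue])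
  finally have "oslash_power_measure G (pmf_of_set (E G)) (Suc n) = pmf_of_set (E ?K)" .
  moreover have "scaled_metric (Suc n) ?K (oslash_power_metric G d (Suc n))"
    using scaled_metric_rename[OF scaled_metric_oslash[OF H dH dG] wfO inj_on_cls[OF H]] by (simp add: n')
  moreover have "card (E ?K) = card (E G) ^ Suc n" using card_glue[OF H glue] cH by simp
  moreover have "\<exists>fs. spectral_family (Suc n) ?K fs" using spectral_family_glue[OF H glue _ cH] fH by blast
  moreover have "oslash_power G (Suc n) = ?K" by (simp add: n')
  ultimately show ?case using wf_graph_glue[OF H glue] by simp
qed

text \<open>The first constant is 2 divided by the L1 norm of the normalised
  \<open>\<phi>\<close>.\<close>

lemma lipschitz_spectral_profile_spectral_family:
  assumes H: "wf_graph H" and d: "scaled_metric n H d" and fs: "spectral_family n H fs"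
    and "edge_abs_sum G \<phi> > 0" and "card (E G) \<ge> k"
  shows "lipschitz_spectral_profile (graph_of H) (vertex_measure H (pmf_of_set (E H))) d
    (ln (real (card (E G))) / ln (real k)) (real k ^ n)
    (4 * real (card (E G)) / edge_abs_sum G \<phi>) 1 (2 * (real (card (E G)))\<^sup>2)"
proof -
  let ?N = "card (E G)"
  let ?\<mu> = "vertex_measure H (pmf_of_set (E H))"
  let ?C1 = "4 * real ?N / edge_abs_sum G \<phi>"
  let ?\<delta> = "ln (real ?N) / ln (real k)"
  define P where "P m f \<longleftrightarrow> (\<forall>e\<in>E H. \<bar>f (fst e) - f (snd e)\<bar> \<le> real k ^ m / real k ^ n)" for m and f :: "'a \<Rightarrow> real"
  have N: "real ?N > 0" using card_pos by simp
  have cardH: "real (card (E H)) > 0"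
    using H wf_graph_finite_arcs[OF H] by (auto simp: wf_graph_def card_gt_0_iff)
  have k0: "real k > 0" using k by simp
  have f_le: "\<bar>f x\<bar> \<le> 1" if "f \<in> set fs" "x \<in> V H" for f x using fs that by (auto simp: spectral_family_def)
  have f_sum: "edge_abs_sum G \<phi> * card (E H) \<le> 2 * ?N * edge_abs_sum H f" if "f \<in> set fs" for f
    using fs that by (auto simp: spectral_family_def)
  have count: "?N ^ m \<le> 2 * ?N * length (filter (P m) fs)" if "m \<le> n" for m
    using fs that unfolding spectral_family_def P_def by blast
  \<comment> \<open>The count at \<open>m = 0\<close> forces a nonempty family, which keeps the
    infimum below the supremum.\<close>
  have ne: "fs \<noteq> []" using count[of 0] by auto
  have L1: "ennreal (1 / ?C1) \<le> L1_norm ?\<mu> f" if "f \<in> set fs" for f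
    unfolding L1_norm_vertex_measure[OF H] using f_sum[OF that] N cardH
    by (intro ennreal_leI) (simp add: field_simps)
  have Linf: "Linf_norm ?\<mu> f \<le> ennreal 1" if "f \<in> set fs" for f
    using f_le[OF that] by (rule Linf_norm_vertex_measure_le)
  have lip: "Lip_const (V H) d f \<le> real k ^ m" if "P m f" for m f
    unfolding Lip_const_def
  proof (rule cInf_lower)
    have "\<bar>f x - f y\<bar> \<le> real k ^ m * d x y" if xy: "x \<in> V H" "y \<in> V H" for x y
    proof -
      obtain i where i: "(x, y) \<in> sym_arcs (E H) ^^ i" "d x y = real i * (1 / real k ^ n)"
        using d xy unfolding scaled_metric_def by blast
      have "\<bar>f x - f y\<bar> \<le> real i * (real k ^ m / real k ^ n)"
        using \<open>P m f\<close> by (intro relpow_diff_le[OF _ i(1)]) (auto simp: P_def)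
      then show ?thesis using i(2) by (simp add: field_simps)
    qed
    then show "real k ^ m \<in> {L. 0 \<le> L \<and> (\<forall>x\<in>V H. \<forall>y\<in>V H. \<bar>f x - f y\<bar> \<le> L * d x y)}" by simp
    show "bdd_below {L. 0 \<le> L \<and> (\<forall>x\<in>V H. \<forall>y\<in>V H. \<bar>f x - f y\<bar> \<le> L * d x y)}"
      by (rule bdd_belowI[of _ 0]) auto
  qed
  have card_ge: "s powr ?\<delta> / (2 * (real ?N)\<^sup>2) \<le> card {i \<in> {..<length fs}. Lip_const (V H) d (fs ! i) \<le> s}"
    if s: "s \<in> {1..real k ^ n}" for s
  proof -
    \<comment> \<open>Bounding \<open>s\<close> by \<open>k ^ Suc m\<close> while counting functions
      for \<open>k ^ m\<close> costs one factor \<open>card (E G)\<close>; together with the factor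
      in \<open>count\<close> this makes \<open>2 * (real ?N)\<^sup>2\<close>.\<close>
    obtain m where m: "m \<le> n" "real k ^ m \<le> s" "s \<le> real k ^ Suc m"
      using between_powers[of s k n] s k by auto
    have "s powr ?\<delta> \<le> (real k ^ Suc m) powr ?\<delta>"
      using m(3) s card_pos k by (intro powr_mono2) auto
    also have "\<dots> = real ?N ^ Suc m" using k card_pos by (rule power_powr_log)
    also have "\<dots> \<le> real ?N * (2 * real ?N * length (filter (P m) fs))"
      using of_nat_mono[OF count[OF m(1)], where 'a = real] unfolding power_Suc
      by (intro mult_left_mono) simp_all
    finally have "s powr ?\<delta> / (2 * (real ?N)\<^sup>2) \<le> length (filter (P m) fs)"
      using N by (simp add: field_simps power2_eq_square)
    also have "length (filter (P m) fs) = card {i. i < length fs \<and> P m (fs ! i)}"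
      by (rule length_filter_conv_card)
    also have "\<dots> \<le> card {i \<in> {..<length fs}. Lip_const (V H) d (fs ! i) \<le> s}"
      using lip m(2) by (intro card_mono) (auto intro: order_trans)
    finally show ?thesis by simp
  qed
  have orth: "(\<integral>x. (fs ! i) x * (fs ! j) x \<partial>?\<mu>) = 0" if "i < length fs" "j < length fs" "i \<noteq> j" for i j
  proof -
    have sorted: "edge_orthogonal H (fs ! i) (fs ! j)" if "i < j" "j < length fs" for i j
      using fs that unfolding spectral_family_def by (simp add: sorted_wrt_iff_nth_less)
    show ?thesis
    proof (cases "i < j")
      case True
      then show ?thesis using integral_edge_orthogonal[OF H sorted] that by simp
    next
      case False
      then show ?thesis using integral_edge_orthogonal[OF H sorted, of j i] that by (simp add: mult.commute)
    qed
  qed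
  have "(INF i\<in>{..<length fs}. L1_norm ?\<mu> (fs ! i)) \<le> L1_norm ?\<mu> (fs ! 0)"
    using ne by (intro INF_lower) auto
  also have "\<dots> \<le> Linf_norm ?\<mu> (fs ! 0)" by (rule L1_norm_le_Linf_norm[OF H])
  also have "\<dots> \<le> (SUP i\<in>{..<length fs}. Linf_norm ?\<mu> (fs ! i))"
    using ne by (intro SUP_upper) auto
  finally have INF_SUP: "(INF i\<in>{..<length fs}. L1_norm ?\<mu> (fs ! i)) \<le>
    (SUP i\<in>{..<length fs}. Linf_norm ?\<mu> (fs ! i))" .
  have "1 \<le> ?\<delta>" using k assms(5) by (simp add: field_simps)
  moreover have "1 \<le> real k ^ n" using k by (intro one_le_power) simp
  moreover have "0 < ?C1" "0 < 2 * (real ?N)\<^sup>2" using N assms(4) by simp_all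
  moreover have "ennreal (1 / ?C1) \<le> (INF i\<in>{..<length fs}. L1_norm ?\<mu> (fs ! i))"
    using L1 by (intro INF_greatest) simp
  moreover have "(SUP i\<in>{..<length fs}. Linf_norm ?\<mu> (fs ! i)) \<le> ennreal 1"
    using Linf by (intro SUP_least) simp
  ultimately show ?thesis
    unfolding lipschitz_spectral_profile_def using INF_SUP orth card_ge
    by (intro conjI exI[of _ "{..<length fs}"] exI[of _ "\<lambda>i. fs ! i"]) auto
qed

end

section \<open>Consequences of the hypotheses\<close>

text \<open>Connectivity is read off the geodesic metric, whose distances are realised by
  walks.\<close>

lemma st_graph_wf_graph:
  assumes st: "st_graph G" and d: "geodesic_metric (graph_of G) d" "\<forall>e\<in>E G. edge_len d e = c"
  shows "wf_graph G"
proof -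
  have adm: "pair_digraph (graph_of G)" "E G \<noteq> {}"
    using st by (auto simp: st_graph_def admissible_graph_def)
  interpret pair_digraph "graph_of G" by fact
  have "(x, y) \<in> (sym_arcs (E G))\<^sup>*" if "x \<in> V G" "y \<in> V G" for x y
    using geodesic_metric_relpow[OF d that] relpow_imp_rtrancl by blast
  moreover have "E G \<subseteq> V G \<times> V G" using in_arcsD1 in_arcsD2 by auto
  ultimately show ?thesis
    using adm(2) no_loops' finite_verts unfolding wf_graph_def by (metis with_proj_simps(1))
qed

lemma collapsing_map_step:
  assumes "collapsing_map k G \<pi>" "f \<in> E G" "k > 0"
  shows "\<exists>j\<in>{1..k}. \<pi> (fst f) = (real j - 1) / k \<and> \<pi> (snd f) = real j / k"
proof -
  have "map_prod \<pi> \<pi> f \<in> path_edge k ` {1..k}"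
    using assms by (auto simp: collapsing_map_def graph_morphism_def path_graph_def)
  then show ?thesis by (cases f) (auto simp: path_edge_def)
qed

text \<open>A path from source to sink has to cross every level of the collapsing map.\<close>

lemma collapsing_map_level_nonempty:
  assumes wf: "wf_graph G" and "source G \<in> V G" "sink G \<in> V G"
    and \<pi>: "collapsing_map k G \<pi>" and j: "j \<in> {1..k}"
  shows "\<exists>f\<in>E G. \<pi> (fst f) = (real j - 1) / k"
proof (rule ccontr)
  assume none: "\<not> ?thesis"
  have k: "k > 0" using j by auto
  have ends: "\<pi> (source G) = 0" "\<pi> (sink G) = 1" using \<pi> unfolding collapsing_map_def by blast+
  \<comment> \<open>If no edge starts at level \<open>(j - 1) / k\<close>, no edge leads across it,
    so the vertices at or below this level are closed under adjacency.\<close>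
  have level: "\<pi> (snd f) \<le> (real j - 1) / k \<longleftrightarrow> \<pi> (fst f) \<le> (real j - 1) / k" if f: "f \<in> E G" for f
  proof -
    obtain i where i: "i \<in> {1..k}" "\<pi> (fst f) = (real i - 1) / k" "\<pi> (snd f) = real i / k"
      using collapsing_map_step[OF \<pi> f k] by blast
    then have "i < j \<or> j < i" using none f by (metis nat_neq_iff)
    then have "real i + 1 \<le> real j \<or> real j + 1 \<le> real i" by (auto simp: nat_less_real_le)
    then have "real i \<le> real j - 1 \<longleftrightarrow> real i - 1 \<le> real j - 1" by linarith
    then show ?thesis using i k by (simp add: divide_le_cancel)
  qed
  have "(source G, sink G) \<in> (sym_arcs (E G))\<^sup>*" using assms unfolding wf_graph_def by blast
  then have "\<pi> (sink G) \<le> (real j - 1) / k"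
  proof (induction)
    case base
    then show ?case using ends j by auto
  next
    case (step y z)
    then show ?case using level[of "(y, z)"] level[of "(z, y)"] by auto
  qed
  then show False using ends j k by (auto simp: field_simps)
qed

text \<open>Each of the \<open>k\<close> levels contains the tail of an edge. This makes the
  dimension at least 1.\<close>

lemma collapsing_map_card_ge:
  assumes wf: "wf_graph G" and "source G \<in> V G" "sink G \<in> V G" and \<pi>: "collapsing_map k G \<pi>"
  shows "card (E G) \<ge> k"
proof -
  have "(\<lambda>j. (real j - 1) / k) ` {1..k} \<subseteq> (\<lambda>f. \<pi> (fst f)) ` E G"
    using collapsing_map_level_nonempty[OF assms] by (force simp: image_iff)
  then have "card ((\<lambda>j. (real j - 1) / k) ` {1..k}) \<le> card (E G)"
    using wf_graph_finite_arcs[OF wf] by (meson card_image_le card_mono finite_imageI le_trans)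
  moreover have "inj_on (\<lambda>j. (real j - 1) / k) {1..k}" by (rule inj_onI) auto
  ultimately show ?thesis by (simp add: card_image)
qed

text \<open>Integrating the conditional expectation over the fibre, a set of the generated
  sigma-algebra, gives the integral of \<open>g\<close> over it.\<close>

lemma sum_fibre_zero:
  assumes fin: "finite (E G)" and ne: "E G \<noteq> {}"
    and mor: "graph_morphism G (path_graph k) \<pi>"
    and zero: "AE e in edge_space G (pmf_of_set (E G)).
      collapsing_cond_exp k G \<pi> (pmf_of_set (E G)) g e = 0"
  shows "(\<Sum>e\<in>{e \<in> E G. \<pi> (fst e) = c}. g e) = 0"
proof -
  define M where "M = edge_space G (pmf_of_set (E G))"
  define F where "F = vimage_algebra (E G) (map_prod \<pi> \<pi>) (count_space (E (path_graph k)))"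
  define A where "A = {e \<in> E G. \<pi> (fst e) = c}"
  have space: "space M = E G" by (simp add: M_def edge_space_def space_restrict_space)
  have sets: "sets M = Pow (E G)" by (auto simp: M_def edge_space_def sets_restrict_space)
  have meas: "h \<in> borel_measurable M" for h :: "_ \<Rightarrow> real"
    using sets by (intro measurableI) (auto simp: space)
  have intM: "integral\<^sup>L M h = (\<Sum>e\<in>E G. h e) / card (E G)" for h :: "_ \<Rightarrow> real"
    unfolding M_def edge_space_def using fin ne
    by (subst integral_restrict_space) (auto simp: integral_pmf_of_set intro!: sum.cong)
  have integrable: "integrable M h" for h :: "_ \<Rightarrow> real"
  proof -
    have "finite (set_pmf (pmf_of_set (E G)))" using fin ne by simp
    then show ?thesis
      unfolding M_def edge_space_def
      by (subst integrable_restrict_space) (auto intro: integrable_measure_pmf_finite)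
  qed
  have "finite_measure M" unfolding M_def edge_space_def by (intro finite_measure_restrict_space) auto
  moreover have subalg: "subalgebra M F"
    using sets sets.sets_into_space[of _ F] unfolding subalgebra_def space F_def by auto
  ultimately have "finite_measure_subalgebra M F"
    by (intro finite_measure_subalgebra.intro finite_measure_subalgebra_axioms.intro)
  then interpret finite_measure_subalgebra M F .
  \<comment> \<open>The fibre is the preimage of the path edges with left end
    \<open>c\<close>.\<close>
  have "A \<in> sets F"
  proof -
    have "A = map_prod \<pi> \<pi> -` {x \<in> E (path_graph k). fst x = c} \<inter> E G"
      using mor by (auto simp: A_def graph_morphism_def)
    then show ?thesis unfolding F_def by (simp only:) (rule in_vimage_algebra, simp)
  qed
  then have "(\<integral>e\<in>A. g e \<partial>M) = (\<integral>e\<in>A. real_cond_exp M F g e \<partial>M)"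
    by (intro real_cond_exp_intA integrable)
  also have "\<dots> = (\<integral>e. 0 \<partial>M)"
    unfolding set_lebesgue_integral_def
    using zero meas unfolding collapsing_cond_exp_def M_def[symmetric] F_def[symmetric]
    by (intro integral_cong_AE) auto
  finally have "(\<Sum>e\<in>E G. indicator A e *\<^sub>R g e) / card (E G) = 0"
    unfolding set_lebesgue_integral_def intM by simp
  then have "(\<Sum>e\<in>E G. indicator A e *\<^sub>R g e) = 0" using fin ne by simp
  also have "(\<Sum>e\<in>E G. indicator A e *\<^sub>R g e) = (\<Sum>e\<in>E G. if e \<in> A then g e else 0)"
    by (intro sum.cong) (auto simp: indicator_def)
  also have "\<dots> = (\<Sum>e\<in>A. g e)"
    using fin by (subst sum.inter_restrict[symmetric]) (auto simp: A_def intro!: sum.cong)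
  finally show ?thesis by (simp add: A_def)
qed

text \<open>Reflecting \<open>j\<close> to \<open>k + 1 - j\<close> turns
  \<open>(2 * j - 1) / k\<close> into 2 minus itself, so the sum \<open>S\<close> equals
  \<open>2 * card (E G) - S\<close>.\<close>

lemma reflection_invariant_mean:
  assumes fin: "finite (E G)" and ne: "E G \<noteq> {}" and k: "k > 0"
    and mor: "graph_morphism G (path_graph k) \<pi>"
    and reflect: "reflection_invariant k (map_pmf (map_prod \<pi> \<pi>) (pmf_of_set (E G)))"
  shows "(\<Sum>f\<in>E G. \<pi> (fst f) + \<pi> (snd f)) = card (E G)"
proof -
  define c where "c j = (\<Sum>f\<in>{f \<in> E G. map_prod \<pi> \<pi> f = path_edge k j}. (1::real))" for j
  have inj: "inj_on (path_edge k) {1..k}" by (rule inj_onI) (use k in \<open>auto simp: path_edge_def\<close>)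
  have group: "(\<Sum>f\<in>E G. h (map_prod \<pi> \<pi> f)) = (\<Sum>j=1..k. c j * h (path_edge k j))"
    for h :: "real \<times> real \<Rightarrow> real"
  proof -
    have "(\<Sum>f\<in>E G. h (map_prod \<pi> \<pi> f)) =
      (\<Sum>y\<in>path_edge k ` {1..k}. \<Sum>f\<in>{f \<in> E G. map_prod \<pi> \<pi> f = y}. h (map_prod \<pi> \<pi> f))"
      using mor fin by (intro sum.group[symmetric]) (auto simp: graph_morphism_def path_graph_def)
    also have "\<dots> = (\<Sum>j=1..k. \<Sum>f\<in>{f \<in> E G. map_prod \<pi> \<pi> f = path_edge k j}. h (map_prod \<pi> \<pi> f))"
      by (subst sum.reindex[OF inj]) simp
    also have "\<dots> = (\<Sum>j=1..k. c j * h (path_edge k j))"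
      unfolding c_def sum_distrib_right by (intro sum.cong refl) auto
    finally show ?thesis .
  qed
  have c_refl: "c (k + 1 - j) = c j" if j: "j \<in> {1..k}" for j
  proof -
    have pmf: "pmf (map_pmf (map_prod \<pi> \<pi>) (pmf_of_set (E G))) (path_edge k i) = c i / card (E G)" for i
      unfolding pmf_map measure_pmf_of_set[OF ne fin] c_def
      by (simp add: Int_def vimage_def conj_commute)
    have "c j / card (E G) = c (k - j + 1) / card (E G)"
      using reflect j unfolding reflection_invariant_def pmf by blast
    moreover have "k - j + 1 = k + 1 - j" using j by auto
    moreover have "card (E G) \<noteq> 0" using fin ne by simp
    ultimately show ?thesis by simp
  qed
  define S where "S = (\<Sum>j=1..k. c j * ((2 * real j - 1) / k))"
  have sum: "(\<Sum>f\<in>E G. \<pi> (fst f) + \<pi> (snd f)) = S"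
    using group[of "\<lambda>x. fst x + snd x"] unfolding S_def path_edge_def
    by (simp add: add_divide_distrib[symmetric])
  have card: "card (E G) = (\<Sum>j=1..k. c j)"
    using group[of "\<lambda>x. 1"] by simp
  have "S = (\<Sum>j=1..k. c (k + 1 - j) * ((2 * real (k + 1 - j) - 1) / k))"
    unfolding S_def by (subst sum.atLeastAtMost_rev) simp
  also have "\<dots> = (\<Sum>j=1..k. 2 * c j - c j * ((2 * real j - 1) / k))"
  proof (rule sum.cong[OF refl])
    fix j assume j: "j \<in> {1..k}"
    have "real (k + 1 - j) = real k + 1 - real j" using j by (simp add: of_nat_diff)
    then show "c (k + 1 - j) * ((2 * real (k + 1 - j) - 1) / k) = 2 * c j - c j * ((2 * real j - 1) / k)"
      unfolding c_refl[OF j] using k by (simp add: field_simps)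
  qed
  also have "\<dots> = 2 * card (E G) - S"
    unfolding sum_subtractf S_def[symmetric] sum_distrib_left[symmetric] card[symmetric] by simp
  finally show ?thesis using sum by simp
qed

lemma sum_weighted_fibre_zero:
  fixes g h :: "'a \<Rightarrow> real" and w :: "real \<Rightarrow> real"
  assumes "finite A" and "\<And>c. (\<Sum>e\<in>{e \<in> A. h e = c}. g e) = 0"
  shows "(\<Sum>e\<in>A. w (h e) * g e) = 0"
proof -
  have "(\<Sum>e\<in>A. w (h e) * g e) = (\<Sum>c\<in>h ` A. \<Sum>e\<in>{e \<in> A. h e = c}. w (h e) * g e)"
    using assms(1) by (rule sum.image_gen)
  also have "\<dots> = (\<Sum>c\<in>h ` A. w c * (\<Sum>e\<in>{e \<in> A. h e = c}. g e))"
    unfolding sum_distrib_left by (intro sum.cong refl) auto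
  finally show ?thesis using assms(2) by simp
qed

text \<open>All edges in the first level of the collapsing map start at the source, and all edges in the
  last level end at the sink, so the two conditional expectations force a base function to vanish
  at both.\<close>

lemma collapsing_graph_normalized:
  assumes k: "k \<ge> 2" and wf: "wf_graph G"
    and ends: "source G \<in> V G" "sink G \<in> V G" "source G \<noteq> sink G"
    and \<pi>: "collapsing_map k G \<pi>"
    and reflect: "reflection_invariant k (map_pmf (map_prod \<pi> \<pi>) (pmf_of_set (E G)))"
    and base: "base_function k G \<pi> \<phi>"
    and M: "M > 0" "\<And>x. x \<in> V G \<Longrightarrow> \<bar>\<phi> x\<bar> \<le> M"
  shows "collapsing_graph G k \<pi> (\<lambda>x. \<phi> x / M)"
proof -
  have k0: "k > 0" using k by simp
  have fin: "finite (E G)" "E G \<noteq> {}" using wf wf_graph_finite_arcs[OF wf] by (auto simp: wf_graph_def)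
  have mor: "graph_morphism G (path_graph k) \<pi>" using \<pi> by (simp add: collapsing_map_def)
  have pi0: "\<pi> x = 0 \<longleftrightarrow> x = source G" and pi1: "\<pi> x = 1 \<longleftrightarrow> x = sink G" if "x \<in> V G" for x
    using \<pi> that ends unfolding collapsing_map_def by blast+
  have step: "\<exists>j\<in>{1..k}. \<pi> (fst f) = (real j - 1) / k \<and> \<pi> (snd f) = real j / k" if "f \<in> E G" for f
    using collapsing_map_step[OF \<pi> that k0] .
  have pi_step: "\<pi> (snd f) = \<pi> (fst f) + 1 / k" if "f \<in> E G" for f
    using step[OF that] by (auto simp: diff_divide_distrib)
  have pi_range: "0 \<le> \<pi> u \<and> \<pi> u \<le> 1" if "u \<in> V G" for u
  proof -
    have "\<pi> u \<in> {real i / real k | i. i \<le> k}"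
      using that mor by (auto simp: graph_morphism_def path_graph_def)
    then show ?thesis by (auto simp: divide_le_eq)
  qed
  have fst0: "(\<Sum>e\<in>{e \<in> E G. \<pi> (fst e) = c}. \<phi> (fst e)) = 0"
    and snd0: "(\<Sum>e\<in>{e \<in> E G. \<pi> (fst e) = c}. \<phi> (snd e)) = 0" for c
    using base sum_fibre_zero[OF fin mor] unfolding base_function_def Let_def by blast+
  have phi_source: "\<phi> (source G) = 0"
  proof -
    let ?A = "{e \<in> E G. \<pi> (fst e) = 0}"
    obtain e where e: "e \<in> E G" "source G \<in> {fst e, snd e}" using wf_graph_incident[OF wf ends(1)] by blast
    \<comment> \<open>Heads of edges have positive level, so the source can only be the tail of
      \<open>e\<close>.\<close>
    have "\<pi> (snd e) \<noteq> 0" using step[OF e(1)] k by auto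
    then have "e \<in> ?A" using e pi0[OF ends(1)] by auto
    moreover have "finite ?A" using fin by simp
    ultimately have "card ?A > 0" unfolding card_gt_0_iff by blast
    moreover have "(\<Sum>e\<in>?A. \<phi> (fst e)) = (\<Sum>e\<in>?A. \<phi> (source G))"
      using pi0 wf_graph_arcD[OF wf] by (intro sum.cong) auto
    ultimately show ?thesis using fst0[of 0] by simp
  qed
  have phi_sink: "\<phi> (sink G) = 0"
  proof -
    let ?A = "{e \<in> E G. \<pi> (fst e) = 1 - 1 / k}"
    obtain e where e: "e \<in> E G" "sink G \<in> {fst e, snd e}" using wf_graph_incident[OF wf ends(2)] by blast
    \<comment> \<open>The fibre is indexed by the level of the tail, whereas \<open>\<phi>\<close>
      is evaluated at the head, one step higher.\<close>
    have A: "f \<in> ?A \<longleftrightarrow> \<pi> (snd f) = 1" if "f \<in> E G" for f using that pi_step[OF that] by auto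
    have "\<pi> (fst e) \<noteq> 1" using step[OF e(1)] k by auto
    then have "e \<in> ?A" using e pi1[OF ends(2)] A by auto
    moreover have "finite ?A" using fin by simp
    ultimately have "card ?A > 0" unfolding card_gt_0_iff by blast
    moreover have "(\<Sum>e\<in>?A. \<phi> (snd e)) = (\<Sum>e\<in>?A. \<phi> (sink G))"
    proof (rule sum.cong[OF refl])
      fix f assume f: "f \<in> ?A"
      then have "\<pi> (snd f) = 1" using A[of f] by simp
      then show "\<phi> (snd f) = \<phi> (sink G)" using pi1 wf_graph_arcD[OF wf] f by auto
    qed
    ultimately show ?thesis using snd0[of "1 - 1 / k"] by simp
  qed
  have mean: "(\<Sum>f\<in>E G. \<pi> (fst f) + \<pi> (snd f)) = card (E G)"
    by (rule reflection_invariant_mean[OF fin k0 mor reflect])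
  have interior: "fst e \<notin> {source G, sink G} \<or> snd e \<notin> {source G, sink G}" if "e \<in> E G" for e
  proof (rule ccontr)
    assume "\<not> ?thesis"
    \<comment> \<open>The two levels would differ by an integer, but an edge raises the level by
      \<open>1 / k\<close>, which is strictly between 0 and 1.\<close>
    then have "\<pi> (fst e) \<in> {0, 1}" "\<pi> (snd e) \<in> {0, 1}" using pi0 pi1 ends by auto
    then show False using pi_step[OF that] k by (auto simp: field_simps)
  qed
  have sign: "\<phi> (fst f) * \<phi> (snd f) \<ge> 0" if "f \<in> E G" for f
    using base that by (auto simp: base_function_def edge_sign_property_def)
  have zero: "(\<Sum>f\<in>E G. w (\<pi> (fst f)) * \<phi> (fst f)) = 0" "(\<Sum>f\<in>E G. w (\<pi> (fst f)) * \<phi> (snd f)) = 0" for w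
    using sum_weighted_fibre_zero[OF fin(1) fst0] sum_weighted_fibre_zero[OF fin(1) snd0] by auto
  show ?thesis
  proof
    show "\<pi> (source G) = 0" "\<pi> (sink G) = 1" using pi0 pi1 ends by auto
    show "\<phi> u / M = 0" if "u \<in> {source G, sink G}" for u using that phi_source phi_sink by auto
    show "\<bar>\<phi> u / M\<bar> \<le> 1" if "u \<in> V G" for u using M(1) M(2)[OF that] by simp
    show "\<phi> (fst f) / M * (\<phi> (snd f) / M) \<ge> 0" if "f \<in> E G" for f using sign[OF that] M(1) by simp
    show "(\<Sum>f\<in>E G. w (\<pi> (fst f)) * (\<phi> (fst f) / M)) = 0" for w
      using zero(1) by (simp add: sum_divide_distrib[symmetric])
    show "(\<Sum>f\<in>E G. w (\<pi> (fst f)) * (\<phi> (snd f) / M)) = 0" for w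
      using zero(2) by (simp add: sum_divide_distrib[symmetric])
  qed (use wf ends interior k pi_range pi_step mean in auto)
qed

theorem corollary4:
  fixes k :: nat
    and G :: "'a st_digraph"
    and \<pi> :: "'a \<Rightarrow> real"
    and \<nu> :: "('a \<times> 'a) pmf"
    and d :: "'a \<Rightarrow> 'a \<Rightarrow> real"
    and \<phi> :: "'a \<Rightarrow> real"
  assumes "k \<ge> 2"
    and "st_graph G"
    and "collapsing_map k G \<pi>"
    and "set_pmf \<nu> \<subseteq> E G"
    and "geodesic_metric (graph_of G) d"
    and "\<nu> = pmf_of_set (E G)"
    and "reflection_invariant k (map_pmf (map_prod \<pi> \<pi>) \<nu>)"
    and "base_function k G \<pi> \<phi>"
    and "\<exists>x \<in> V G. \<phi> x \<noteq> 0"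
    and "\<forall>e \<in> E G. edge_len d e = 1 / real k"
  shows "\<forall>n \<ge> 1. \<exists>C1 Cinf C\<gamma>.
    lipschitz_spectral_profile
      (graph_of (oslash_power G n))
      (vertex_measure (oslash_power G n) (oslash_power_measure G \<nu> n))
      (oslash_power_metric G d n)
      (ln (real (card (E G))) / ln (real k)) (real k ^ n)
      C1 Cinf C\<gamma> \<and>
    ennreal C1 \<le> 2 * (Linf_norm (vertex_measure G \<nu>) \<phi> / L1_norm (vertex_measure G \<nu>) \<phi>) \<and>
    Cinf \<le> 1 \<and>
    C\<gamma> \<le> 2 * (real (card (E G)))\<^sup>2"
proof (intro allI impI)
  fix n :: nat assume n: "n \<ge> 1"
  have wf: "wf_graph G" by (rule st_graph_wf_graph[OF assms(2,5,10)])
  have ends: "source G \<in> V G" "sink G \<in> V G" "source G \<noteq> sink G"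
    using assms(2) by (auto simp: st_graph_def)
  have fin: "finite (V G)" "finite (E G)" using wf wf_graph_finite_arcs by (auto simp: wf_graph_def)
  \<comment> \<open>Dividing by the maximum bounds the base function by 1, which leads to
    \<open>Cinf = 1\<close>.\<close>
  define M where "M = Max ((\<lambda>x. \<bar>\<phi> x\<bar>) ` V G)"
  have M_ge: "\<bar>\<phi> x\<bar> \<le> M" if "x \<in> V G" for x unfolding M_def using fin(1) that by simp
  obtain x0 where x0: "x0 \<in> V G" "\<phi> x0 \<noteq> 0" using assms(9) by blast
  have M0: "M > 0" using M_ge[OF x0(1)] x0(2) by linarith
  have "M \<in> (\<lambda>x. \<bar>\<phi> x\<bar>) ` V G" unfolding M_def using fin(1) x0(1) by (intro Max_in) auto
  then obtain x1 where x1: "x1 \<in> V G" "\<bar>\<phi> x1\<bar> = M" by auto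
  define \<psi> where "\<psi> x = \<phi> x / M" for x
  have "collapsing_graph G k \<pi> (\<lambda>x. \<phi> x / M)"
    using assms(1,3,7,8) wf ends M0 M_ge unfolding assms(6) by (intro collapsing_graph_normalized)
  then interpret collapsing_graph G k \<pi> \<psi> unfolding \<psi>_def[abs_def] .
  have "edge_abs_sum G \<phi> > 0"
  proof -
    obtain e where e: "e \<in> E G" "x0 \<in> {fst e, snd e}" using wf_graph_incident[OF wf x0(1)] by blast
    then show ?thesis
      unfolding edge_abs_sum_def using fin x0(2) by (intro sum_pos2[of _ e]) auto
  qed
  moreover have psi_sum: "edge_abs_sum G \<psi> = edge_abs_sum G \<phi> / M"
    using M0 by (simp add: edge_abs_sum_def \<psi>_def sum_divide_distrib add_divide_distrib)
  ultimately have sum_pos: "edge_abs_sum G \<phi> > 0" "edge_abs_sum G \<psi> > 0" using M0 by auto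
  let ?K = "oslash_power G n"
  let ?C1 = "4 * real (card (E G)) / edge_abs_sum G \<psi>"
  have "scaled_metric 1 G d" using assms(5,10) by (intro scaled_metric_geodesic) auto
  from oslash_power_structure[OF this n] obtain fs where K: "wf_graph ?K"
    "oslash_power_measure G \<nu> n = pmf_of_set (E ?K)" "scaled_metric n ?K (oslash_power_metric G d n)"
    "spectral_family n ?K fs"
    unfolding assms(6) by blast
  have "lipschitz_spectral_profile (graph_of ?K) (vertex_measure ?K (oslash_power_measure G \<nu> n))
      (oslash_power_metric G d n) (ln (real (card (E G))) / ln (real k)) (real k ^ n)
      ?C1 1 (2 * (real (card (E G)))\<^sup>2)"
    unfolding K(2)
    by (rule lipschitz_spectral_profile_spectral_family[OF K(1,3,4) sum_pos(2)
          collapsing_map_card_ge[OF wf ends(1,2) assms(3)]])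
  moreover have "ennreal ?C1 \<le> 2 * (Linf_norm (vertex_measure G \<nu>) \<phi> / L1_norm (vertex_measure G \<nu>) \<phi>)"
  proof -
    \<comment> \<open>\<open>?l\<close> is the L1 norm of \<open>\<phi>\<close>; undoing the
      normalisation turns \<open>?C1\<close> into \<open>2 * (M / ?l)\<close>.\<close>
    let ?l = "edge_abs_sum G \<phi> / (2 * card (E G))"
    have l: "?l > 0" using sum_pos(1) card_pos by simp
    have "?C1 = 2 * (M / ?l)" unfolding psi_sum using M0 sum_pos(1) card_pos by (simp add: field_simps)
    then have "ennreal ?C1 = ennreal (2 * (M / ?l))" by (simp only:)
    also have "\<dots> = 2 * ennreal (M / ?l)"
      using ennreal_mult[of 2 "M / ?l"] divide_pos_pos[OF M0 l] by simp
    also have "\<dots> = 2 * (ennreal M / ennreal ?l)"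
      using l M0 by (simp only: divide_ennreal less_imp_le)
    \<comment> \<open>\<open>M\<close> is attained at the vertex \<open>x1\<close>, which has
      positive mass.\<close>
    also have "\<dots> \<le> 2 * (Linf_norm (vertex_measure G \<nu>) \<phi> / ennreal ?l)"
      using Linf_norm_vertex_measure_ge[OF wf x1(1), of \<phi>] x1(2) unfolding assms(6)
      by (intro mult_left_mono divide_right_mono_ennreal) auto
    finally show ?thesis unfolding assms(6) L1_norm_vertex_measure[OF wf] .
  qed
  ultimately show "\<exists>C1 Cinf C\<gamma>.
    lipschitz_spectral_profile
      (graph_of (oslash_power G n))
      (vertex_measure (oslash_power G n) (oslash_power_measure G \<nu> n))
      (oslash_power_metric G d n)
      (ln (real (card (E G))) / ln (real k)) (real k ^ n)
      C1 Cinf C\<gamma> \<and>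
    ennreal C1 \<le> 2 * (Linf_norm (vertex_measure G \<nu>) \<phi> / L1_norm (vertex_measure G \<nu>) \<phi>) \<and>
    Cinf \<le> 1 \<and>
    C\<gamma> \<le> 2 * (real (card (E G)))\<^sup>2"
    by (intro exI conjI) auto
qed

end
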